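(* Let $G_1,G_2$ be connected simple noncompact real algebraic groups, $\Gamma<G_1$ a Zariski dense discrete subgroup with limit set $\Lambda$, and $\rho:\Gamma\to G_2$ a discrete faithful Zariski dense representation admitting a boundary map $f:\Lambda\to\mathcal F_2$. Let $\nu_1$ be a $(\Gamma,\psi_1)$-conformal measure on $\Lambda$ and $\nu_2$ a $(\rho(\Gamma),\psi_2)$-conformal measure on $\Lambda_{\rho(\Gamma)}$, where $\psi_i\in\mathfrak a_i^*$. If $$\mathsf E_{(\mathrm{id}\times f)_*\nu_1}(\Gamma_\rho)\not\subset\{(u_1,u_2)\in\mathfrak a=\mathfrak a_1\oplus\mathfrak a_2:\psi_1(u_1)=\psi_2(u_2)\},$$ then $$(f^{-1}\times\mathrm{id})_*\nu_2\not\ll(\mathrm{id}\times f)_*\nu_1\quad\text{and hence}\quad \nu_2\not\ll f_*\nu_1.$$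
   Context: For a connected semisimple real algebraic group $G$: fix a Cartan decomposition $\mathfrak g=\mathfrak k\oplus\mathfrak p$, the maximal compact subgroup $K$ with Lie algebra $\mathfrak k$, a maximal abelian subalgebra $\mathfrak a\subset\mathfrak p$, a closed positive Weyl chamber $\mathfrak a^+$, $A=\exp\mathfrak a$, $A^+=\exp\mathfrak a^+$, $M$ the centralizer of $A$ in $K$, $N=\{g\in G: a^{-n}ga^n\to e\text{ as }n\to+\infty\}$ for $a\in\operatorname{int}A^+$, $P=MAN$, $\mathcal F=G/P\cong K/M$ the Furstenberg boundary, $X=G/K$ with base point $o=[K]$. Subscripts $i=1,2$ denote these objects for $G_i$. For $G=G_1\times G_2$ all objects are taken to be products: $K=K_1\times K_2$, $P=P_1\times P_2$, $\mathcal F=\mathcal F_1\times\mathcal F_2$, $X=X_1\times X_2$, $o=(o_1,o_2)$, $\mathfrak a=\mathfrak a_1\oplus\mathfrak a_2$; $\|\cdot\|$ is a fixed Weyl-group invariant norm on $\mathfrak a$. Busemann map: for $g\in G$, $\xi=[k]\in K/M=\mathcal F$, define $H(g,\xi)\in\mathfrak a$ by $gk\in K\exp(H(g,\xi))N$; set $\beta_\xi([g],[h])=H(g^{-1},\xi)-H(h^{-1},\xi)$. Conformal measures: for a discrete subgroup $\Delta<G$ and $\psi\in\mathfrak a^*$, a Borel probability measure $\nu$ on $\mathcal F$ is $(\Delta,\psi)$-conformal (with respect to $o$) if $\frac{dg_*\nu}{d\nu}(\eta)=e^{\psi(\beta_\eta(o,go))}$ for all $g\in\Delta$, $\eta\in\mathcal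 F$. The same definitions apply to $G_1$ and $G_2$. Limit set: $g_\ell o\to\xi\in\mathcal F$ means $\alpha(\mu(g_\ell))\to\infty$ for every simple root $\alpha$ (with $\mu(g)\in\mathfrak a^+$, $g\in K\exp(\mu(g))K$) and $\kappa_\ell P\to\xi$, where $\kappa_\ell\in K$, $g_\ell\in\kappa_\ell A^+K$. $\Lambda_\Delta$ is the set of all limits of sequences $g_\ell o$, $g_\ell\in\Delta$; $\Lambda=\Lambda_\Gamma$. A $\rho$-boundary map is a $\rho$-equivariant continuous embedding $f:\Lambda\to\mathcal F_2$; one has $f(\Lambda)=\Lambda_{\rho(\Gamma)}$, and $f^{-1}:\Lambda_{\rho(\Gamma)}\to\Lambda$. Here $\mathrm{id}\times f:\xi\mapsto(\xi,f(\xi))$ and $f^{-1}\times\mathrm{id}:\eta\mapsto(f^{-1}(\eta),\eta)$. The self-joining is $\Gamma_\rho=\{(\gamma,\rho(\gamma)):\gamma\in\Gamma\}<G$; $(\mathrm{id}\times f)_*\nu_1$ is a $\Gamma_\rho$-conformal measure. Essential subgroup: for a $\Gamma_\rho$-conformal measure $\nu$, $\mathsf E_\nu(\Gamma_\rho)\subset\mathfrak a$ is the set of all $u\in\mathfrak a$ such that for every Borel $B\subset\mathcal F$ with $\nu(B)>0$ and every $\varepsilon>0$ there is $g\in\Gamma_\rho$ with $\nu\big(B\cap gB\cap\{\xi\in\mathcal F:\|\beta_\xi(o,go)-u\|<\varepsilon\}\big)>0$. $\nu_1\ll\nu_2$ means absolute continuity. *)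

theory Defs
  imports "HOL-Probability.Probability_Measure" "HOL-Algebra.Coset"
begin

section \<open>Real algebraic groups\<close>

text \<open>The product \<open>**\<close> is the matrix product; the class operation \<open>*\<close> on this type is
  componentwise and is not used.\<close>

type_synonym 'n mat = "real ^ 'n ^ 'n"

definition GL :: "('n::finite) mat monoid" where
  "GL = \<lparr>carrier = {A. invertible A}, mult = (**), one = mat 1\<rparr>"

definition zariski_closure :: "('n::finite) mat set \<Rightarrow> 'n mat set" where
  "zariski_closure S =
     {x. \<forall>p. real_polynomial_function p \<and> (\<forall>y\<in>S. p y = 0) \<longrightarrow> p x = 0}"

text \<open>Only used for \<open>S \<subseteq> G\<close>.\<close>

definition zariski_dense_in :: "('n::finite) mat set \<Rightarrow> 'n mat set \<Rightarrow> bool" where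
  "zariski_dense_in S G \<longleftrightarrow> G \<subseteq> zariski_closure S"

text \<open>A connected real algebraic group is the identity component, for the Euclidean topology, of
  the group of real points of a linear algebraic group defined over the reals.\<close>

definition connected_real_algebraic_group :: "('n::finite) mat set \<Rightarrow> bool" where
  "connected_real_algebraic_group G \<longleftrightarrow>
     (\<exists>H Q. subgroup H GL \<and> (\<forall>p\<in>Q. real_polynomial_function p) \<and>
        H = {A. invertible A \<and> (\<forall>p\<in>Q. p A = 0)} \<and>
        G = connected_component_set H (mat 1))"

section \<open>Lie algebras\<close>

definition matpow :: "('n::finite) mat \<Rightarrow> nat \<Rightarrow> 'n mat" where
  "matpow A n = (((**) A) ^^ n) (mat 1)"

definition mexp :: "('n::finite) mat \<Rightarrow> 'n mat" where
  "mexp X = (\<Sum>n. (1 / fact n) *\<^sub>R matpow X n)"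

definition lie_algebra :: "('n::finite) mat set \<Rightarrow> 'n mat set" where
  "lie_algebra G = {X. \<forall>t::real. mexp (t *\<^sub>R X) \<in> G}"

definition bracket :: "('n::finite) mat \<Rightarrow> 'n mat \<Rightarrow> 'n mat" where
  "bracket X Y = X ** Y - Y ** X"

definition simple_lie_algebra :: "('n::finite) mat set \<Rightarrow> bool" where
  "simple_lie_algebra g \<longleftrightarrow>
     (\<exists>X\<in>g. \<exists>Y\<in>g. bracket X Y \<noteq> 0) \<and>
     (\<forall>I. subspace I \<and> I \<subseteq> g \<and> (\<forall>X\<in>g. \<forall>Y\<in>I. bracket X Y \<in> I) \<longrightarrow> I = {0} \<or> I = g)"

definition connected_simple_real_algebraic_group :: "('n::finite) mat set \<Rightarrow> bool" where
  "connected_simple_real_algebraic_group G \<longleftrightarrow>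
     connected_real_algebraic_group G \<and> simple_lie_algebra (lie_algebra G)"

text \<open>Trace of an endomorphism \<open>T\<close> of the subspace \<open>V\<close>; the choice of basis is immaterial.\<close>

definition trace_on :: "('n::finite) mat set \<Rightarrow> ('n mat \<Rightarrow> 'n mat) \<Rightarrow> real" where
  "trace_on V T =
     (let B = (SOME B. independent B \<and> span B = V) in \<Sum>b\<in>B. representation B (T b) b)"

definition killing_form :: "('n::finite) mat set \<Rightarrow> 'n mat \<Rightarrow> 'n mat \<Rightarrow> real" where
  "killing_form g X Y = trace_on g (\<lambda>Z. bracket X (bracket Y Z))"

definition cartan_decomposition ::
    "('n::finite) mat set \<Rightarrow> 'n mat set \<Rightarrow> 'n mat set \<Rightarrow> bool" where
  "cartan_decomposition g k p \<longleftrightarrow>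
     subspace k \<and> subspace p \<and> k \<inter> p = {0} \<and> g = {X + Y | X Y. X \<in> k \<and> Y \<in> p} \<and>
     (\<forall>X\<in>k. \<forall>Y\<in>k. bracket X Y \<in> k) \<and>
     (\<forall>X\<in>k. \<forall>Y\<in>p. bracket X Y \<in> p) \<and>
     (\<forall>X\<in>p. \<forall>Y\<in>p. bracket X Y \<in> k) \<and>
     (\<forall>X\<in>k. X \<noteq> 0 \<longrightarrow> killing_form g X X < 0) \<and>
     (\<forall>Y\<in>p. Y \<noteq> 0 \<longrightarrow> killing_form g Y Y > 0)"

definition maximal_compact_subgroup :: "('n::finite) mat set \<Rightarrow> 'n mat set \<Rightarrow> bool" where
  "maximal_compact_subgroup K G \<longleftrightarrow>
     subgroup K GL \<and> K \<subseteq> G \<and> compact K \<and>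
     (\<forall>L. subgroup L GL \<and> L \<subseteq> G \<and> compact L \<and> K \<subseteq> L \<longrightarrow> L = K)"

definition maximal_abelian_in :: "('n::finite) mat set \<Rightarrow> 'n mat set \<Rightarrow> bool" where
  "maximal_abelian_in a p \<longleftrightarrow>
     subspace a \<and> a \<subseteq> p \<and> (\<forall>X\<in>a. \<forall>Y\<in>a. bracket X Y = 0) \<and>
     (\<forall>b. subspace b \<and> b \<subseteq> p \<and> (\<forall>X\<in>b. \<forall>Y\<in>b. bracket X Y = 0) \<and> a \<subseteq> b \<longrightarrow> b = a)"

definition dual_space :: "('n::finite) mat set \<Rightarrow> ('n mat \<Rightarrow> real) set" where
  "dual_space a = {\<psi>. (\<forall>u\<in>a. \<forall>v\<in>a. \<psi> (u + v) = \<psi> u + \<psi> v) \<and>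
                      (\<forall>c. \<forall>u\<in>a. \<psi> (c *\<^sub>R u) = c * \<psi> u)}"

text \<open>Restricted roots, as functions on \<open>a\<close> (extensional, so that they are determined by their
  values there). Linearity on \<open>a\<close> follows from the eigenvector equation.\<close>

definition restricted_roots :: "('n::finite) mat set \<Rightarrow> 'n mat set \<Rightarrow> ('n mat \<Rightarrow> real) set" where
  "restricted_roots g a =
     {\<alpha> \<in> extensional a. (\<exists>v\<in>a. \<alpha> v \<noteq> 0) \<and>
        (\<exists>X\<in>g. X \<noteq> 0 \<and> (\<forall>v\<in>a. bracket v X = \<alpha> v *\<^sub>R X))}"

definition closed_weyl_chamber ::
    "('n::finite) mat set \<Rightarrow> 'n mat set \<Rightarrow> 'n mat set \<Rightarrow> bool" where
  "closed_weyl_chamber g a C \<longleftrightarrow>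
     (\<exists>U \<in> components (a - (\<Union>\<alpha>\<in>restricted_roots g a. {v. \<alpha> v = 0})). C = closure U)"

section \<open>Groups with a choice of Cartan data\<close>

record 'n cartan_group =
  Grp :: "'n mat set"
  Kgrp :: "'n mat set"
  plie :: "'n mat set"
  alie :: "'n mat set"
  aplus :: "'n mat set"

definition cartan_group :: "('n::finite) cartan_group \<Rightarrow> bool" where
  "cartan_group D \<longleftrightarrow>
     cartan_decomposition (lie_algebra (Grp D)) (lie_algebra (Kgrp D)) (plie D) \<and>
     maximal_compact_subgroup (Kgrp D) (Grp D) \<and>
     maximal_abelian_in (alie D) (plie D) \<and>
     closed_weyl_chamber (lie_algebra (Grp D)) (alie D) (aplus D)"

definition positive_roots :: "('n::finite) cartan_group \<Rightarrow> ('n mat \<Rightarrow> real) set" where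
  "positive_roots D = {\<alpha> \<in> restricted_roots (lie_algebra (Grp D)) (alie D). \<forall>v\<in>aplus D. \<alpha> v \<ge> 0}"

definition simple_roots :: "('n::finite) cartan_group \<Rightarrow> ('n mat \<Rightarrow> real) set" where
  "simple_roots D = {\<alpha> \<in> positive_roots D.
     \<not> (\<exists>\<beta>\<in>positive_roots D. \<exists>\<gamma>\<in>positive_roots D. \<forall>v\<in>alie D. \<alpha> v = \<beta> v + \<gamma> v)}"

definition Agrp :: "('n::finite) cartan_group \<Rightarrow> 'n mat set" where
  "Agrp D = mexp ` alie D"

definition Mgrp :: "('n::finite) cartan_group \<Rightarrow> 'n mat set" where
  "Mgrp D = {k \<in> Kgrp D. \<forall>a\<in>Agrp D. k ** a = a ** k}"

text \<open>The group \<open>N\<close> does not depend on the element \<open>a\<close> of the interior of \<open>exp aplus\<close>.\<close>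

definition Ngrp :: "('n::finite) cartan_group \<Rightarrow> 'n mat set" where
  "Ngrp D = {g \<in> Grp D. \<forall>a \<in> mexp ` (top_of_set (alie D) interior_of aplus D).
     (\<lambda>n. matpow (matrix_inv a) n ** g ** matpow a n) \<longlonglongrightarrow> mat 1}"

definition Pgrp :: "('n::finite) cartan_group \<Rightarrow> 'n mat set" where
  "Pgrp D = {m ** a ** n | m a n. m \<in> Mgrp D \<and> a \<in> Agrp D \<and> n \<in> Ngrp D}"

section \<open>The Furstenberg boundary\<close>

text \<open>Points of \<open>G/P\<close> are left cosets; \<open>[k]\<close> in \<open>K/M\<close> corresponds to the coset \<open>kP\<close>.\<close>

definition flag_point :: "('n::finite) cartan_group \<Rightarrow> 'n mat \<Rightarrow> 'n mat set" where
  "flag_point D g = g <#\<^bsub>GL\<^esub> Pgrp D"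

definition flag_action :: "('n::finite) mat \<Rightarrow> 'n mat set \<Rightarrow> 'n mat set" where
  "flag_action g \<xi> = g <#\<^bsub>GL\<^esub> \<xi>"

definition flag_openin :: "('n::finite) cartan_group \<Rightarrow> 'n mat set set \<Rightarrow> bool" where
  "flag_openin D U \<longleftrightarrow> U \<subseteq> flag_point D ` Grp D \<and>
     openin (top_of_set (Grp D)) {g \<in> Grp D. flag_point D g \<in> U}"

text \<open>The quotient topology on \<open>G/P\<close>.\<close>

definition flag_topology :: "('n::finite) cartan_group \<Rightarrow> 'n mat set topology" where
  "flag_topology D = topology (flag_openin D)"

lemma openin_flag_topology: "openin (flag_topology D) = flag_openin D"
proof -
  have "istopology (flag_openin D)"
    unfolding istopology_def
  proof (intro conjI allI impI)
    fix S T assume "flag_openin D S" "flag_openin D T"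
    moreover have "{g \<in> Grp D. flag_point D g \<in> S \<inter> T} =
        {g \<in> Grp D. flag_point D g \<in> S} \<inter> {g \<in> Grp D. flag_point D g \<in> T}"
      by blast
    ultimately show "flag_openin D (S \<inter> T)"
      by (auto simp: flag_openin_def)
  next
    fix \<K> assume K: "\<forall>S\<in>\<K>. flag_openin D S"
    have "{g \<in> Grp D. flag_point D g \<in> \<Union>\<K>} = (\<Union>S\<in>\<K>. {g \<in> Grp D. flag_point D g \<in> S})"
      by blast
    moreover have "openin (top_of_set (Grp D)) (\<Union>S\<in>\<K>. {g \<in> Grp D. flag_point D g \<in> S})"
      using K by (intro openin_Union) (auto simp: flag_openin_def)
    moreover have "\<Union>\<K> \<subseteq> flag_point D ` Grp D"
      using K by (auto simp: flag_openin_def)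
    ultimately show "flag_openin D (\<Union>\<K>)"
      by (simp only: flag_openin_def)
  qed
  then show ?thesis
    by (simp add: flag_topology_def)
qed

lemma topspace_flag_topology: "topspace (flag_topology D) = flag_point D ` Grp D"
proof -
  have "{g \<in> Grp D. flag_point D g \<in> flag_point D ` Grp D} = Grp D"
    by blast
  then have "flag_openin D (flag_point D ` Grp D)"
    by (auto simp: flag_openin_def)
  then show ?thesis
    unfolding topspace_def openin_flag_topology by (auto simp: flag_openin_def)
qed

section \<open>Busemann map and limit set\<close>

text \<open>The value \<open>H(g,\<xi>)\<close> in \<open>a\<close>: for \<open>\<xi> = [k]\<close>, \<open>gk\<close> lies in \<open>K exp(H(g,\<xi>)) N\<close>.\<close>

definition iwasawa_cocycle :: "('n::finite) cartan_group \<Rightarrow> 'n mat \<Rightarrow> 'n mat set \<Rightarrow> 'n mat" where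
  "iwasawa_cocycle D g \<xi> =
     (THE v. v \<in> alie D \<and>
        (\<exists>k\<in>Kgrp D. \<xi> = flag_point D k \<and>
           (\<exists>l\<in>Kgrp D. \<exists>n\<in>Ngrp D. g ** k = l ** mexp v ** n)))"

text \<open>\<open>busemann D \<xi> g h\<close> is the Busemann map at \<open>\<xi>\<close> of the points \<open>gK\<close> and \<open>hK\<close> of \<open>G/K\<close>;
  the base point is represented by the identity matrix.\<close>

definition busemann ::
    "('n::finite) cartan_group \<Rightarrow> 'n mat set \<Rightarrow> 'n mat \<Rightarrow> 'n mat \<Rightarrow> 'n mat" where
  "busemann D \<xi> g h =
     iwasawa_cocycle D (matrix_inv g) \<xi> - iwasawa_cocycle D (matrix_inv h) \<xi>"

definition cartan_projection :: "('n::finite) cartan_group \<Rightarrow> 'n mat \<Rightarrow> 'n mat" where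
  "cartan_projection D g =
     (THE v. v \<in> aplus D \<and> (\<exists>k\<in>Kgrp D. \<exists>l\<in>Kgrp D. g = k ** mexp v ** l))"

definition converges_to_flag ::
    "('n::finite) cartan_group \<Rightarrow> (nat \<Rightarrow> 'n mat) \<Rightarrow> 'n mat set \<Rightarrow> bool" where
  "converges_to_flag D g \<xi> \<longleftrightarrow>
     (\<forall>\<alpha>\<in>simple_roots D. filterlim (\<lambda>l. \<alpha> (cartan_projection D (g l))) at_top sequentially) \<and>
     (\<exists>\<kappa>. (\<forall>l. \<kappa> l \<in> Kgrp D \<and> (\<exists>v\<in>aplus D. \<exists>k\<in>Kgrp D. g l = \<kappa> l ** mexp v ** k)) \<and>
          limitin (flag_topology D) (\<lambda>l. flag_point D (\<kappa> l)) \<xi> sequentially)"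

definition limit_set :: "('n::finite) cartan_group \<Rightarrow> 'n mat set \<Rightarrow> 'n mat set set" where
  "limit_set D \<Delta> = {\<xi>. \<exists>g. (\<forall>l. g l \<in> \<Delta>) \<and> converges_to_flag D g \<xi>}"

section \<open>Conformal measures\<close>

definition borel_of :: "'a topology \<Rightarrow> 'a measure" where
  "borel_of X = sigma (topspace X) {U. openin X U}"

definition has_RN_derivative :: "'a measure \<Rightarrow> 'a measure \<Rightarrow> ('a \<Rightarrow> real) \<Rightarrow> bool" where
  "has_RN_derivative \<mu> \<nu> \<phi> \<longleftrightarrow>
     \<phi> \<in> borel_measurable \<nu> \<and> \<mu> = density \<nu> (\<lambda>x. ennreal (\<phi> x))"

definition conformal_measure ::
    "('n::finite) cartan_group \<Rightarrow> 'n mat set \<Rightarrow> ('n mat \<Rightarrow> real) \<Rightarrow> 'n mat set measure \<Rightarrow> bool" where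
  "conformal_measure D \<Delta> \<psi> \<nu> \<longleftrightarrow>
     prob_space \<nu> \<and> sets \<nu> = sets (borel_of (flag_topology D)) \<and>
     (\<forall>g\<in>\<Delta>. has_RN_derivative (distr \<nu> \<nu> (flag_action g)) \<nu>
                (\<lambda>\<eta>. exp (\<psi> (busemann D \<eta> (mat 1) g))))"

text \<open>Image of a measure concentrated on \<open>S\<close> under a map defined on \<open>S\<close>.\<close>

definition push_measure ::
    "'a measure \<Rightarrow> 'a set \<Rightarrow> 'b topology \<Rightarrow> ('a \<Rightarrow> 'b) \<Rightarrow> 'b measure" where
  "push_measure \<nu> S Y h = distr (restrict_space \<nu> S) (borel_of Y) h"

section \<open>Boundary maps\<close>

definition boundary_map ::
    "('n::finite) cartan_group \<Rightarrow> ('m::finite) cartan_group \<Rightarrow> 'n mat set \<Rightarrow> ('n mat \<Rightarrow> 'm mat) \<Rightarrow>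
     ('n mat set \<Rightarrow> 'm mat set) \<Rightarrow> bool" where
  "boundary_map D1 D2 \<Gamma> \<rho> f \<longleftrightarrow>
     embedding_map (subtopology (flag_topology D1) (limit_set D1 \<Gamma>)) (flag_topology D2) f \<and>
     (\<forall>\<gamma>\<in>\<Gamma>. \<forall>\<xi>\<in>limit_set D1 \<Gamma>. f (flag_action \<gamma> \<xi>) = flag_action (\<rho> \<gamma>) (f \<xi>))"

section \<open>Products and the essential subgroup\<close>

definition self_joining :: "('n::finite) mat set \<Rightarrow> ('n mat \<Rightarrow> 'm mat) \<Rightarrow> ('n mat \<times> ('m::finite) mat) set" where
  "self_joining \<Gamma> \<rho> = (\<lambda>\<gamma>. (\<gamma>, \<rho> \<gamma>)) ` \<Gamma>"

definition prod_flag_topology ::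
    "('n::finite) cartan_group \<Rightarrow> ('m::finite) cartan_group \<Rightarrow> ('n mat set \<times> 'm mat set) topology" where
  "prod_flag_topology D1 D2 = prod_topology (flag_topology D1) (flag_topology D2)"

definition prod_flag_action ::
    "('n::finite) mat \<times> ('m::finite) mat \<Rightarrow> 'n mat set \<times> 'm mat set \<Rightarrow> 'n mat set \<times> 'm mat set" where
  "prod_flag_action g \<xi> = (flag_action (fst g) (fst \<xi>), flag_action (snd g) (snd \<xi>))"

definition prod_busemann ::
    "('n::finite) cartan_group \<Rightarrow> ('m::finite) cartan_group \<Rightarrow> 'n mat set \<times> 'm mat set \<Rightarrow>
     'n mat \<times> 'm mat \<Rightarrow> 'n mat \<times> 'm mat \<Rightarrow> 'n mat \<times> 'm mat" where
  "prod_busemann D1 D2 \<xi> g h =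
     (busemann D1 (fst \<xi>) (fst g) (fst h), busemann D2 (snd \<xi>) (snd g) (snd h))"

text \<open>The Weyl group acts on \<open>a\<close> through the adjoint action of the normalizer of \<open>a\<close> in \<open>K\<close>.\<close>

definition normalizer_K :: "('n::finite) cartan_group \<Rightarrow> 'n mat set" where
  "normalizer_K D = {k \<in> Kgrp D. (\<lambda>v. k ** v ** matrix_inv k) ` alie D = alie D}"

definition weyl_invariant_norm ::
    "('n::finite) cartan_group \<Rightarrow> ('m::finite) cartan_group \<Rightarrow> ('n mat \<times> 'm mat \<Rightarrow> real) \<Rightarrow> bool" where
  "weyl_invariant_norm D1 D2 nrm \<longleftrightarrow>
     (\<forall>u \<in> alie D1 \<times> alie D2. nrm u \<ge> 0 \<and> (nrm u = 0 \<longleftrightarrow> u = 0)) \<and>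
     (\<forall>c. \<forall>u \<in> alie D1 \<times> alie D2. nrm (c *\<^sub>R u) = \<bar>c\<bar> * nrm u) \<and>
     (\<forall>u \<in> alie D1 \<times> alie D2. \<forall>v \<in> alie D1 \<times> alie D2. nrm (u + v) \<le> nrm u + nrm v) \<and>
     (\<forall>k1 \<in> normalizer_K D1. \<forall>k2 \<in> normalizer_K D2. \<forall>u1 \<in> alie D1. \<forall>u2 \<in> alie D2.
        nrm (k1 ** u1 ** matrix_inv k1, k2 ** u2 ** matrix_inv k2) = nrm (u1, u2))"

text \<open>The norm is constrained on \<open>a\<close> only, so it is applied under the guard that the Busemann map
  takes its value in \<open>a\<close>; by the Iwasawa decomposition this holds everywhere.\<close>

definition essential_subgroup ::
    "('n::finite) cartan_group \<Rightarrow> ('m::finite) cartan_group \<Rightarrow> ('n mat \<times> 'm mat \<Rightarrow> real) \<Rightarrow>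
     ('n mat set \<times> 'm mat set) measure \<Rightarrow> ('n mat \<times> 'm mat) set \<Rightarrow> ('n mat \<times> 'm mat) set" where
  "essential_subgroup D1 D2 nrm \<nu> \<Delta> =
     {u \<in> alie D1 \<times> alie D2.
        \<forall>B \<in> sets (borel_of (prod_flag_topology D1 D2)). emeasure \<nu> B > 0 \<longrightarrow>
          (\<forall>\<epsilon>>0. \<exists>g\<in>\<Delta>.
             emeasure \<nu> (B \<inter> prod_flag_action g ` B \<inter>
               {\<xi> \<in> topspace (prod_flag_topology D1 D2).
                  prod_busemann D1 D2 \<xi> (mat 1, mat 1) g \<in> alie D1 \<times> alie D2 \<and>
                  nrm (prod_busemann D1 D2 \<xi> (mat 1, mat 1) g - u) < \<epsilon>}) > 0)}"

end

theory Submission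
  imports Defs
begin

text \<open>Put \<open>\<mu> = (id \<times> f)\<^sub>* \<nu>\<^sub>1\<close> and \<open>\<sigma> = (f\<inverse> \<times> id)\<^sub>* \<nu>\<^sub>2\<close>, and suppose \<open>\<sigma> = \<phi> \<mu>\<close>. Comparing the two
  conformality relations, \<open>ln \<phi>\<close> cobounds the difference of the cocycles:
  \<open>ln \<phi> (g\<inverse> x) + \<psi>\<^sub>1 (\<beta>\<^sub>x(o, go)\<^sub>1) = ln \<phi> x + \<psi>\<^sub>2 (\<beta>\<^sub>x(o, go)\<^sub>2)\<close> for almost every \<open>x\<close>. On a set \<open>B\<close> of
  positive measure where \<open>ln \<phi>\<close> is almost constant, every return to \<open>B\<close> therefore makes
  \<open>\<psi>\<^sub>1 - \<psi>\<^sub>2\<close> small at the Busemann vector, so that vector cannot be close to a vector \<open>u\<close> with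
  \<open>\<psi>\<^sub>1 u\<^sub>1 \<noteq> \<psi>\<^sub>2 u\<^sub>2\<close>. The push-forwards are meaningful because limit sets are closed: \<open>G \<rightarrow> G/P\<close> is
  open, so \<open>G/P\<close> is first countable, and since there are finitely many simple roots a diagonal
  sequence realises any limit of limit points.\<close>

section \<open>Simultaneous eigenvalues and norms on subspaces\<close>

text \<open>Eigenvectors attached to distinct joint eigenvalue functions are linearly independent,
  so there are at most as many as the dimension. Extensionality makes two functions that agree on
  \<open>A\<close> equal.\<close>

lemma simultaneous_eigenvalues_finite:
  fixes L :: "'a \<Rightarrow> 'v::euclidean_space \<Rightarrow> 'v"
  assumes lin: "\<And>v. v \<in> A \<Longrightarrow> linear (L v)"
    and R: "R \<subseteq> extensional A"
    and ev: "\<And>\<alpha>. \<alpha> \<in> R \<Longrightarrow> \<exists>X. X \<noteq> 0 \<and> (\<forall>v\<in>A. L v X = \<alpha> v *\<^sub>R X)"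
  shows "finite (R :: ('a \<Rightarrow> real) set)"
proof -
  obtain X where X0: "\<And>\<alpha>. \<alpha> \<in> R \<Longrightarrow> X \<alpha> \<noteq> 0"
    and LX: "\<And>\<alpha> v. \<alpha> \<in> R \<Longrightarrow> v \<in> A \<Longrightarrow> L v (X \<alpha>) = \<alpha> v *\<^sub>R X \<alpha>"
    using ev by metis
  have indep: "\<forall>\<alpha>\<in>S. c \<alpha> = 0"
    if "finite S" "S \<subseteq> R" "(\<Sum>\<alpha>\<in>S. c \<alpha> *\<^sub>R X \<alpha>) = 0" for S and c :: "('a \<Rightarrow> real) \<Rightarrow> real"
    using that
  proof (induction S arbitrary: c rule: finite_induct)
    case empty
    then show ?case by simp
  next
    case (insert \<beta> S)
    then have bR: "\<beta> \<in> R" and SR: "S \<subseteq> R" by auto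
    have sum0: "c \<beta> *\<^sub>R X \<beta> + (\<Sum>\<alpha>\<in>S. c \<alpha> *\<^sub>R X \<alpha>) = 0"
      using insert.prems insert.hyps by simp
    \<comment> \<open>Applying \<open>L v\<close> to the relation and subtracting
      \<open>\<beta> v\<close> times the relation cancels the term at \<beta>; the induction
      hypothesis is used with the new coefficients.\<close>
    have coeff: "\<forall>\<alpha>\<in>S. c \<alpha> * (\<alpha> v - \<beta> v) = 0" if v: "v \<in> A" for v
    proof (rule insert.IH[OF SR])
      interpret linear "L v" by (rule lin[OF v])
      have "0 = L v (c \<beta> *\<^sub>R X \<beta> + (\<Sum>\<alpha>\<in>S. c \<alpha> *\<^sub>R X \<alpha>))"
        by (simp add: sum0)
      also have "\<dots> = c \<beta> *\<^sub>R \<beta> v *\<^sub>R X \<beta> + (\<Sum>\<alpha>\<in>S. c \<alpha> *\<^sub>R \<alpha> v *\<^sub>R X \<alpha>)"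
        using SR by (simp add: add scale sum LX[OF bR v] subset_iff LX[OF _ v] cong: sum.cong)
      finally have 1: "c \<beta> *\<^sub>R \<beta> v *\<^sub>R X \<beta> + (\<Sum>\<alpha>\<in>S. c \<alpha> *\<^sub>R \<alpha> v *\<^sub>R X \<alpha>) = 0" by simp
      have 2: "\<beta> v *\<^sub>R (c \<beta> *\<^sub>R X \<beta>) + (\<Sum>\<alpha>\<in>S. \<beta> v *\<^sub>R (c \<alpha> *\<^sub>R X \<alpha>)) = 0"
        using arg_cong[OF sum0, of "\<lambda>x. \<beta> v *\<^sub>R x"]
        by (simp only: scaleR_add_right scaleR_sum_right scaleR_zero_right)
      show "(\<Sum>\<alpha>\<in>S. (c \<alpha> * (\<alpha> v - \<beta> v)) *\<^sub>R X \<alpha>) = 0"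
        using 1 2 by (simp add: algebra_simps sum_subtractf) (metis add_left_cancel)
    qed
    \<comment> \<open>Distinct members of \<open>R\<close> differ at some \<open>v\<close> in
      \<open>A\<close>, where the factor \<open>\<alpha> v - \<beta> v\<close> can be divided
      out.\<close>
    have S0: "\<forall>\<alpha>\<in>S. c \<alpha> = 0"
    proof
      fix \<alpha> assume a: "\<alpha> \<in> S"
      then have "\<alpha> \<noteq> \<beta>" using insert.hyps by auto
      then obtain v where "v \<in> A" "\<alpha> v \<noteq> \<beta> v"
        using R bR SR a extensionalityI[of \<alpha> A \<beta>] by blast
      then show "c \<alpha> = 0" using coeff a by fastforce
    qed
    then have "c \<beta> *\<^sub>R X \<beta> = 0" using sum0 by simp
    then show ?case using S0 X0[OF bR] by simp
  qed
  \<comment> \<open>A nonzero vector determines its eigenvalue for each \<open>v\<close>. Hence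
    independence of the family passes to its image set, and finiteness of that set passes back to
    \<open>R\<close>.\<close>
  have inj: "inj_on X R"
  proof
    fix \<alpha> \<beta> assume ab: "\<alpha> \<in> R" "\<beta> \<in> R" and eq: "X \<alpha> = X \<beta>"
    have "\<alpha> v = \<beta> v" if "v \<in> A" for v
      using LX[OF ab(1) that] LX[OF ab(2) that] eq X0[OF ab(2)] by simp
    then show "\<alpha> = \<beta>" using R ab extensionalityI[of \<alpha> A \<beta>] by blast
  qed
  have "independent (X ` R)"
    unfolding independent_explicit_module
  proof (intro allI impI)
    fix T u v assume T: "finite T" "T \<subseteq> X ` R" and s: "(\<Sum>v\<in>T. u v *\<^sub>R v) = 0" and v: "v \<in> T"
    obtain S where S: "S \<subseteq> R" "T = X ` S" using T(2) by (auto simp: subset_image_iff)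
    have injS: "inj_on X S" using inj S(1) inj_on_subset by blast
    have "finite S" using T(1) S(2) injS finite_imageD by blast
    moreover have "(\<Sum>\<alpha>\<in>S. (u (X \<alpha>)) *\<^sub>R X \<alpha>) = 0"
      using s unfolding S(2) by (simp add: sum.reindex[OF injS])
    ultimately have "\<forall>\<alpha>\<in>S. u (X \<alpha>) = 0" using indep[of S "u \<circ> X"] S(1) by simp
    then show "u v = 0" using v S(2) by auto
  qed
  then have "finite (X ` R)" using independent_imp_finite by blast
  then show ?thesis using inj finite_imageD by blast
qed

text \<open>Equivalence of norms in finite dimension: compactness of the unit sphere of
  \<open>V\<close> bounds \<open>nrm\<close> below by a multiple of the Euclidean norm, which in
  turn dominates \<open>L\<close>. Everything is relative to \<open>V\<close> because
  \<open>nrm\<close> is assumed to be a norm only there.\<close>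

lemma linear_le_norm_on_subspace:
  fixes V :: "'a::euclidean_space set"
  assumes V: "subspace V"
    and pos: "\<And>v. v \<in> V \<Longrightarrow> nrm v \<ge> 0" "\<And>v. v \<in> V \<Longrightarrow> nrm v = 0 \<Longrightarrow> v = 0"
    and scale: "\<And>c v. v \<in> V \<Longrightarrow> nrm (c *\<^sub>R v) = \<bar>c\<bar> * nrm v"
    and tri: "\<And>u v. u \<in> V \<Longrightarrow> v \<in> V \<Longrightarrow> nrm (u + v) \<le> nrm u + nrm v"
    and L: "\<And>u v. u \<in> V \<Longrightarrow> v \<in> V \<Longrightarrow> L (u + v) = L u + L v"
      "\<And>c v. v \<in> V \<Longrightarrow> L (c *\<^sub>R v) = c * L v"
  obtains C :: real where "C > 0" "\<And>v. v \<in> V \<Longrightarrow> \<bar>L v\<bar> \<le> C * nrm v"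
proof -
  \<comment> \<open>Stated for any seminorm on \<open>V\<close> since it serves twice: for
    \<open>nrm\<close>, to obtain continuity, and for the absolute value of
    \<open>L\<close>.\<close>
  have sub_le: "\<exists>K\<ge>0. \<forall>v\<in>V. p v \<le> K * norm v"
    if p: "\<And>u v. u \<in> V \<Longrightarrow> v \<in> V \<Longrightarrow> p (u + v) \<le> p u + p v"
      "\<And>c v. v \<in> V \<Longrightarrow> p (c *\<^sub>R v) = \<bar>c\<bar> * p v" "\<And>v. v \<in> V \<Longrightarrow> p v \<ge> 0" for p :: "'a \<Rightarrow> real"
  proof -
    obtain B where B: "B \<subseteq> V" "pairwise orthogonal B" "\<And>x. x \<in> B \<Longrightarrow> norm x = 1"
      "independent B" "span B = V"
      using orthonormal_basis_subspace[OF V] by metis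
    have fin: "finite B" using B(4) independent_imp_finite by blast
    have p0: "p 0 = 0" using p(2)[of 0 0] subspace_0[OF V] by simp
    have sum: "p (\<Sum>b\<in>S. c b *\<^sub>R b) \<le> (\<Sum>b\<in>S. \<bar>c b\<bar> * p b) \<and> (\<Sum>b\<in>S. c b *\<^sub>R b) \<in> V"
      if "finite S" "S \<subseteq> B" for S c
      using that
    proof (induction S rule: finite_induct)
      case empty
      then show ?case using p0 subspace_0[OF V] by simp
    next
      case (insert b S)
      let ?s = "\<Sum>b\<in>S. c b *\<^sub>R b"
      have b: "b \<in> V" using B(1) insert.prems by blast
      have s: "p ?s \<le> (\<Sum>b\<in>S. \<bar>c b\<bar> * p b)" "?s \<in> V" using insert by auto
      have cb: "c b *\<^sub>R b \<in> V" using V b by (rule subspace_scale)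
      show ?case
        using p(1)[OF cb s(2)] p(2)[OF b, of "c b"] s subspace_add[OF V cb s(2)] insert.hyps by simp
    qed
    show ?thesis
    proof (intro exI conjI ballI)
      show "0 \<le> (\<Sum>b\<in>B. p b)" using B(1) p(3) by (intro sum_nonneg) auto
      fix v assume v: "v \<in> V"
      have "v = (\<Sum>b\<in>B. (v \<bullet> b) *\<^sub>R b)"
        using orthonormal_basis_expand[OF B(2,3) _ fin] v B(5) by metis
      then have "p v \<le> (\<Sum>b\<in>B. \<bar>v \<bullet> b\<bar> * p b)" using sum[OF fin subset_refl, of "\<lambda>b. v \<bullet> b"] by simp
      also have "\<dots> \<le> (\<Sum>b\<in>B. norm v * p b)"
      proof (intro sum_mono mult_right_mono)
        fix b assume b: "b \<in> B"
        show "\<bar>v \<bullet> b\<bar> \<le> norm v" using Cauchy_Schwarz_ineq2[of v b] B(3)[OF b] by simp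
        show "0 \<le> p b" using b B(1) p(3) by blast
      qed
      finally show "p v \<le> (\<Sum>b\<in>B. p b) * norm v" by (simp add: sum_distrib_left mult.commute)
    qed
  qed
  obtain K where K: "K \<ge> 0" "\<And>v. v \<in> V \<Longrightarrow> nrm v \<le> K * norm v"
    using sub_le[of nrm] pos(1) scale tri by blast
  obtain K' where K': "K' \<ge> 0" "\<And>v. v \<in> V \<Longrightarrow> \<bar>L v\<bar> \<le> K' * norm v"
    using sub_le[of "\<lambda>v. \<bar>L v\<bar>"] L by (auto simp: abs_mult abs_triangle_ineq)
  have diff: "nrm u - nrm v \<le> K * norm (u - v)" if "u \<in> V" "v \<in> V" for u v
    using tri[of v "u - v"] K(2)[of "u - v"] subspace_diff[OF V that] that by simp
  have "\<bar>nrm u - nrm v\<bar> \<le> K * norm (u - v)" if "u \<in> V" "v \<in> V" for u v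
    using diff[OF that] diff[OF that(2,1)] by (simp add: norm_minus_commute abs_if)
  then have "K-lipschitz_on V nrm" using K(1) by (auto simp: lipschitz_on_def dist_norm)
  then have "continuous_on V nrm" by (rule lipschitz_on_continuous_on)
  then have cont: "continuous_on (V \<inter> sphere 0 1) nrm" by (rule continuous_on_subset) auto
  have comp: "compact (V \<inter> sphere 0 1)"
    using closed_subspace[OF V] by (simp add: closed_Int_compact)
  \<comment> \<open>On a trivial subspace the unit sphere is empty, and the value 1 is
    arbitrary.\<close>
  obtain m where m: "m > 0" "\<And>v. v \<in> V \<inter> sphere 0 1 \<Longrightarrow> m \<le> nrm v"
  proof (cases "V \<inter> sphere 0 1 = {}")
    case True
    then show ?thesis using that[of 1] by simp
  next
    case False
    then obtain w where w: "w \<in> V \<inter> sphere 0 1" "\<forall>v\<in>V \<inter> sphere 0 1. nrm w \<le> nrm v"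
      using continuous_attains_inf[OF comp _ cont] by blast
    then have "nrm w > 0" using pos[of w] by (cases "nrm w = 0") auto
    then show ?thesis using that w by blast
  qed
  \<comment> \<open>\<open>K' + 1\<close> in place of \<open>K'\<close> keeps the final constant
    positive also when \<open>K'\<close> is 0.\<close>
  have "\<bar>L v\<bar> \<le> ((K' + 1) / m) * nrm v" if v: "v \<in> V" for v
  proof (cases "v = 0")
    case True
    then show ?thesis using K'(2)[OF v] pos(1)[OF v] m(1) K'(1) by simp
  next
    case False
    let ?w = "inverse (norm v) *\<^sub>R v"
    have "?w \<in> V \<inter> sphere 0 1" using False V v by (simp add: subspace_scale)
    then have "m \<le> inverse (norm v) * nrm v" using m(2)[of ?w] scale[OF v, of "inverse (norm v)"] by simp
    then have n: "m * norm v \<le> nrm v" using False by (simp add: field_simps)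
    have "\<bar>L v\<bar> \<le> (K' + 1) * norm v" using K'(2)[OF v] by (simp add: algebra_simps add_increasing)
    also have "\<dots> = ((K' + 1) / m) * (m * norm v)" using m(1) by simp
    also have "\<dots> \<le> ((K' + 1) / m) * nrm v" using n m(1) K'(1) by (intro mult_left_mono) auto
    finally show ?thesis .
  qed
  moreover have "(K' + 1) / m > 0" using K'(1) m(1) by simp
  ultimately show thesis using that by blast
qed

text \<open>The difference of \<psi>1 and \<psi>2 is a linear functional on the product subspace,
  hence Lipschitz for the norm. This turns closeness of a Busemann vector to a given vector into
  closeness of the values.\<close>

lemma weyl_invariant_norm_dominates_duals:
  assumes nrm: "weyl_invariant_norm D1 D2 nrm"
    and sub: "subspace (alie D1)" "subspace (alie D2)"
    and \<psi>: "\<psi>1 \<in> dual_space (alie D1)" "\<psi>2 \<in> dual_space (alie D2)"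
  obtains C where "C > 0"
    "\<And>u1 u2 v1 v2. u1 \<in> alie D1 \<Longrightarrow> u2 \<in> alie D2 \<Longrightarrow> v1 \<in> alie D1 \<Longrightarrow> v2 \<in> alie D2 \<Longrightarrow>
      \<bar>(\<psi>1 u1 - \<psi>2 u2) - (\<psi>1 v1 - \<psi>2 v2)\<bar> \<le> C * nrm ((u1, u2) - (v1, v2))"
proof -
  let ?V = "alie D1 \<times> alie D2"
  define L where "L v = \<psi>1 (fst v) - \<psi>2 (snd v)" for v
  note n = nrm[unfolded weyl_invariant_norm_def]
  have V: "subspace ?V" using sub by (rule subspace_Times)
  have add: "L (u + v) = L u + L v" if "u \<in> ?V" "v \<in> ?V" for u v
    using \<psi> that by (auto simp: L_def dual_space_def)
  obtain C where C: "C > 0" "\<And>v. v \<in> ?V \<Longrightarrow> \<bar>L v\<bar> \<le> C * nrm v"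
  proof (rule linear_le_norm_on_subspace[OF V, of nrm L])
    show "nrm v \<ge> 0" if "v \<in> ?V" for v using n that by blast
    show "v = 0" if "v \<in> ?V" "nrm v = 0" for v using n that by blast
    show "nrm (c *\<^sub>R v) = \<bar>c\<bar> * nrm v" if "v \<in> ?V" for c v using n that by blast
    show "nrm (u + v) \<le> nrm u + nrm v" if "u \<in> ?V" "v \<in> ?V" for u v using n that by blast
    show "L (c *\<^sub>R v) = c * L v" if "v \<in> ?V" for c v
      using \<psi> that by (auto simp: L_def dual_space_def right_diff_distrib)
  qed (use add in auto)
  show thesis
  proof (rule that[OF C(1)])
    fix u1 u2 v1 v2 assume uv: "u1 \<in> alie D1" "u2 \<in> alie D2" "v1 \<in> alie D1" "v2 \<in> alie D2"
    let ?w = "(u1, u2) - (v1, v2)"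
    have w: "?w \<in> ?V" "(v1, v2) \<in> ?V" using uv subspace_diff[OF sub(1) uv(1,3)] subspace_diff[OF sub(2) uv(2,4)] by auto
    have "L (u1, u2) = L ?w + L (v1, v2)" using add[OF w] by simp
    then show "\<bar>(\<psi>1 u1 - \<psi>2 u2) - (\<psi>1 v1 - \<psi>2 v2)\<bar> \<le> C * nrm ?w"
      using C(2)[OF w(1)] by (simp add: L_def)
  qed
qed

section \<open>The flag space and the limit set\<close>

lemma linear_matrix_mult_left: "linear (\<lambda>X. A ** X)" for A :: "real ^ 'n ^ 'm"
  by (rule linearI) (simp_all add: matrix_add_ldistrib matrix_scalar_ac flip: scalar_matrix_assoc)

lemma linear_matrix_mult_right: "linear (\<lambda>X. X ** A)" for A :: "real ^ 'n ^ 'm"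
  by (rule linearI)
    (simp_all add: matrix_matrix_mult_def vec_eq_iff distrib_right sum.distrib sum_distrib_left mult.assoc)

text \<open>Restricted roots are joint eigenvalues of the brackets with elements of
  \<open>alie D\<close>. Finiteness later lets one index of a sequence serve all simple roots at
  once.\<close>

lemma finite_simple_roots: "finite (simple_roots D)"
proof -
  have "finite (restricted_roots (lie_algebra (Grp D)) (alie D))"
  proof (rule simultaneous_eigenvalues_finite)
    show "linear (bracket v)" for v :: "'a mat"
      unfolding bracket_def[abs_def]
      by (intro linear_compose_sub linear_matrix_mult_left linear_matrix_mult_right)
    show "restricted_roots (lie_algebra (Grp D)) (alie D) \<subseteq> extensional (alie D)"
      by (auto simp: restricted_roots_def)
    show "\<exists>X. X \<noteq> 0 \<and> (\<forall>v\<in>alie D. bracket v X = \<alpha> v *\<^sub>R X)"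
      if "\<alpha> \<in> restricted_roots (lie_algebra (Grp D)) (alie D)" for \<alpha>
      using that by (auto simp: restricted_roots_def)
  qed
  then show ?thesis
    by (rule rev_finite_subset) (auto simp: simple_roots_def positive_roots_def)
qed

section \<open>The identity component as a matrix group\<close>

lemma group_GL: "group (GL :: ('n::finite) mat monoid)"
proof (rule groupI)
  fix x :: "'n mat" assume "x \<in> carrier GL"
  then show "\<exists>y\<in>carrier GL. y \<otimes>\<^bsub>GL\<^esub> x = \<one>\<^bsub>GL\<^esub>"
    by (auto simp: GL_def invertible_def)
qed (auto simp: GL_def invertible_mult matrix_mul_assoc invertible_def[of "mat 1"])

lemma matrix_inv_left_right:
  fixes A :: "real ^ 'n ^ 'n"
  assumes "invertible A"
  shows "matrix_inv A ** A = mat 1" "A ** matrix_inv A = mat 1"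
  using someI_ex[OF assms[unfolded invertible_def]] by (auto simp: matrix_inv_def)

text \<open>The identity component of a topological group is a subgroup: its left translates are
  connected, so each lies in a single component of \<open>H\<close>, and a translate that meets
  \<open>G\<close> lies in \<open>G\<close>.\<close>

lemma
  assumes "connected_real_algebraic_group G"
  shows alg_group_invertible: "g \<in> G \<Longrightarrow> invertible g"
    and alg_group_mult: "g \<in> G \<Longrightarrow> h \<in> G \<Longrightarrow> g ** h \<in> G"
    and alg_group_inv: "g \<in> G \<Longrightarrow> matrix_inv g \<in> G"
proof -
  interpret GL: group "GL :: 'a mat monoid" by (rule group_GL)
  obtain H where H: "subgroup H (GL :: 'a mat monoid)" and G: "G = connected_component_set H (mat 1)"
    using assms by (auto simp: connected_real_algebraic_group_def)
  have HI: "invertible h" if "h \<in> H" for h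
    using subgroup.subset[OF H] that by (auto simp: GL_def)
  have Hm: "g ** h \<in> H" if "g \<in> H" "h \<in> H" for g h
    using subgroup.m_closed[OF H that] by (simp add: GL_def)
  have H1: "mat 1 \<in> H" using subgroup.one_closed[OF H] by (simp add: GL_def)
  have Hi: "matrix_inv h \<in> H" if h: "h \<in> H" for h
  proof -
    have i: "inv\<^bsub>GL\<^esub> h \<in> H" using subgroup.m_inv_closed[OF H h] .
    have "h \<in> carrier GL" using subgroup.subset[OF H] h by blast
    then have "inv\<^bsub>GL\<^esub> h ** h = mat 1" using GL.l_inv[of h] by (simp add: GL_def)
    then have "inv\<^bsub>GL\<^esub> h = matrix_inv h"
      using matrix_inv_left_right[OF HI[OF h]]
      by (metis matrix_mul_assoc matrix_mul_lid matrix_mul_rid)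
    then show ?thesis using i by simp
  qed
  have GH: "G \<subseteq> H" unfolding G by (rule connected_component_subset)
  have G1: "mat 1 \<in> G" unfolding G using H1 by simp
  have conn: "connected ((**) a ` G)" for a
    by (rule connected_linear_image[OF linear_matrix_mult_left]) (simp add: G)
  have translate: "(**) a ` G \<subseteq> connected_component_set H b"
    if "a \<in> H" "b \<in> (**) a ` G" for a b
    by (rule connected_component_maximal[OF that(2) conn]) (use Hm that(1) GH in auto)
  show "g \<in> G \<Longrightarrow> invertible g" using GH HI by blast
  show "g ** h \<in> G" if g: "g \<in> G" and h: "h \<in> G"
  proof -
    have "g \<in> (**) g ` G" using G1 by (metis image_eqI matrix_mul_rid)
    then have "(**) g ` G \<subseteq> connected_component_set H g" using translate g GH by blast
    also have "\<dots> = G" using g unfolding G by (rule connected_component_eq)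
    finally show ?thesis using h by blast
  qed
  show "matrix_inv g \<in> G" if g: "g \<in> G"
  proof -
    have gH: "g \<in> H" using g GH by blast
    have "mat 1 \<in> (**) (matrix_inv g) ` G"
      using g matrix_inv_left_right(1)[OF HI[OF gH]] by (metis image_eqI)
    then have "(**) (matrix_inv g) ` G \<subseteq> G" unfolding G[symmetric]
      using translate[OF Hi[OF gH]] unfolding G by blast
    moreover have "matrix_inv g \<in> (**) (matrix_inv g) ` G" using G1 by (metis image_eqI matrix_mul_rid)
    ultimately show ?thesis by blast
  qed
qed

section \<open>Left translations on the flag space\<close>

lemma flag_action_mult: "flag_action g (flag_action h \<xi>) = flag_action (g ** h) \<xi>"
  by (auto simp: flag_action_def l_coset_def GL_def matrix_mul_assoc)

lemma flag_action_flag_point: "flag_action g (flag_point D h) = flag_point D (g ** h)"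
  using flag_action_mult by (simp add: flag_point_def flag_action_def)

lemma flag_action_one: "flag_action (mat 1) \<xi> = \<xi>"
  by (auto simp: flag_action_def l_coset_def GL_def)

lemma flag_action_inv_left:
  "invertible g \<Longrightarrow> flag_action (matrix_inv g) (flag_action g \<xi>) = \<xi>"
  by (simp add: flag_action_mult matrix_inv_left_right flag_action_one)

text \<open>Left translations use it for continuity of the action on the quotient, right
  translations for openness of the quotient map.\<close>

lemma openin_preimage_linear:
  fixes m :: "('n::finite) mat \<Rightarrow> 'n mat"
  assumes "openin (top_of_set G) V" "linear m" "m ` G \<subseteq> G"
  shows "openin (top_of_set G) {h \<in> G. m h \<in> V}"
proof -
  have "continuous_on G m" using assms(2) linear_continuous_on linear_conv_bounded_linear by blast
  then have "openin (top_of_set G) (G \<inter> m -` V)"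
    using continuous_openin_preimage assms by (metis image_subset_iff_funcset)
  moreover have "G \<inter> m -` V = {h \<in> G. m h \<in> V}" by auto
  ultimately show ?thesis by simp
qed

lemma continuous_map_flag_action:
  assumes G: "connected_real_algebraic_group (Grp D)" and g: "g \<in> Grp D"
  shows "continuous_map (flag_topology D) (flag_topology D) (flag_action g)"
  unfolding continuous_map_def
proof (intro conjI allI impI)
  show "flag_action g \<in> topspace (flag_topology D) \<rightarrow> topspace (flag_topology D)"
    using alg_group_mult[OF G g] by (auto simp: topspace_flag_topology flag_action_flag_point)
  fix U assume "openin (flag_topology D) U"
  then have U: "U \<subseteq> flag_point D ` Grp D" "openin (top_of_set (Grp D)) {h \<in> Grp D. flag_point D h \<in> U}"
    by (auto simp: openin_flag_topology flag_openin_def)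
  have "openin (top_of_set (Grp D)) {h \<in> Grp D. g ** h \<in> {h \<in> Grp D. flag_point D h \<in> U}}"
    by (rule openin_preimage_linear[OF U(2) linear_matrix_mult_left])
      (use alg_group_mult[OF G g] in auto)
  moreover have "{h \<in> Grp D. g ** h \<in> {h \<in> Grp D. flag_point D h \<in> U}} =
    {h \<in> Grp D. flag_point D h \<in> {x \<in> topspace (flag_topology D). flag_action g x \<in> U}}"
    using alg_group_mult[OF G g] by (auto simp: topspace_flag_topology flag_action_flag_point)
  ultimately show "openin (flag_topology D) {x \<in> topspace (flag_topology D). flag_action g x \<in> U}"
    by (auto simp: openin_flag_topology flag_openin_def topspace_flag_topology)
qed

text \<open>If \<open>hP = vP\<close> with \<open>v\<close> in the open set \<open>V\<close>, then \<open>h'P = (h' h\<^sup>-\<^sup>1 v)P\<close> and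
  \<open>h' h\<^sup>-\<^sup>1 v\<close> is in \<open>V\<close> for \<open>h'\<close> near \<open>h\<close>.\<close>

lemma openin_flag_point_image:
  assumes G: "connected_real_algebraic_group (Grp D)" and V: "openin (top_of_set (Grp D)) V"
  shows "openin (flag_topology D) (flag_point D ` V)"
proof -
  have VG: "V \<subseteq> Grp D" using V openin_imp_subset by blast
  let ?W = "{h \<in> Grp D. flag_point D h \<in> flag_point D ` V}"
  have "\<exists>T. openin (top_of_set (Grp D)) T \<and> h \<in> T \<and> T \<subseteq> ?W" if h: "h \<in> ?W" for h
  proof -
    obtain v where v: "v \<in> V" "flag_point D h = flag_point D v" and hG: "h \<in> Grp D" using h by auto
    let ?k = "matrix_inv h ** v"
    have k: "?k \<in> Grp D" using alg_group_mult[OF G alg_group_inv[OF G hG]] v VG by blast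
    have "openin (top_of_set (Grp D)) {h' \<in> Grp D. h' ** ?k \<in> V}"
      by (rule openin_preimage_linear[OF V linear_matrix_mult_right])
        (use alg_group_mult[OF G _ k] in auto)
    moreover have "h ** ?k = v"
      using matrix_inv_left_right[OF alg_group_invertible[OF G hG]] by (simp add: matrix_mul_assoc)
    then have "h \<in> {h' \<in> Grp D. h' ** ?k \<in> V}" using v hG by simp
    moreover have "{h' \<in> Grp D. h' ** ?k \<in> V} \<subseteq> ?W"
    proof safe
      fix h' assume h': "h' \<in> Grp D" "h' ** ?k \<in> V"
      have "flag_point D (h' ** ?k) = flag_action (h' ** matrix_inv h) (flag_point D v)"
        by (simp add: flag_action_flag_point matrix_mul_assoc)
      also have "\<dots> = flag_point D (h' ** (matrix_inv h ** h))"
        unfolding v(2)[symmetric] by (simp add: flag_action_flag_point matrix_mul_assoc)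
      also have "\<dots> = flag_point D h'"
        using matrix_inv_left_right[OF alg_group_invertible[OF G hG]] by simp
      finally show "flag_point D h' \<in> flag_point D ` V" using h'(2) by (metis image_eqI)
    qed
    ultimately show ?thesis by blast
  qed
  then have "openin (top_of_set (Grp D)) ?W" by (subst openin_subopen) blast
  then show ?thesis using VG by (auto simp: openin_flag_topology flag_openin_def)
qed

section \<open>Closedness of limit sets\<close>

lemma limit_set_subset_topspace: "limit_set D \<Delta> \<subseteq> topspace (flag_topology D)"
  by (auto simp: limit_set_def converges_to_flag_def limitin_def)

lemma closedin_limit_set:
  assumes G: "connected_real_algebraic_group (Grp D)"
  shows "closedin (flag_topology D) (limit_set D \<Delta>)"
proof -
  let ?X = "flag_topology D"
  have "\<xi> \<in> limit_set D \<Delta>" if \<xi>: "\<xi> \<in> ?X closure_of limit_set D \<Delta>" for \<xi>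
  proof -
    have "\<xi> \<in> topspace ?X" using \<xi> by (simp add: in_closure_of)
    then obtain g where g: "g \<in> Grp D" "\<xi> = flag_point D g" by (auto simp: topspace_flag_topology)
    \<comment> \<open>The images of shrinking balls about a representative \<open>g\<close> form a
      countable neighbourhood base at \<xi>; they are open because the quotient map is open.\<close>
    define U where "U n = flag_point D ` (Grp D \<inter> ball g (inverse (Suc n)))" for n
    have U: "openin ?X (U n)" "\<xi> \<in> U n" for n
      unfolding U_def using g by (auto intro!: openin_flag_point_image[OF G] openin_open_Int)
    \<comment> \<open>Diagonal choice: for each \<open>n\<close> one term is kept, far along a
      sequence converging to a limit point in \<open>U n\<close>. The lower bound \<open>n\<close>
      on the simple roots forces the chosen sequence to diverge as required.\<close>
    have "\<exists>x \<kappa>. x \<in> \<Delta> \<and> (\<forall>\<alpha>\<in>simple_roots D. \<alpha> (cartan_projection D x) \<ge> real n) \<and>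
        \<kappa> \<in> Kgrp D \<and> (\<exists>v\<in>aplus D. \<exists>k\<in>Kgrp D. x = \<kappa> ** mexp v ** k) \<and> flag_point D \<kappa> \<in> U n" for n
    proof -
      obtain \<eta> where \<eta>: "\<eta> \<in> limit_set D \<Delta>" "\<eta> \<in> U n"
        using \<xi> U[of n] by (auto simp: in_closure_of)
      obtain x \<kappa> where x: "\<And>l. x l \<in> \<Delta>"
        "\<And>\<alpha>. \<alpha> \<in> simple_roots D \<Longrightarrow> filterlim (\<lambda>l. \<alpha> (cartan_projection D (x l))) at_top sequentially"
        "\<And>l. \<kappa> l \<in> Kgrp D" "\<And>l. \<exists>v\<in>aplus D. \<exists>k\<in>Kgrp D. x l = \<kappa> l ** mexp v ** k"
        "limitin ?X (\<lambda>l. flag_point D (\<kappa> l)) \<eta> sequentially"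
        using \<eta>(1) unfolding limit_set_def converges_to_flag_def mem_Collect_eq by fast
      \<comment> \<open>Only finitely many simple roots occur, so their eventual bounds hold
        simultaneously from some index on.\<close>
      have "\<forall>\<^sub>F l in sequentially. \<forall>\<alpha>\<in>simple_roots D. \<alpha> (cartan_projection D (x l)) \<ge> real n"
        using x(2) by (simp add: eventually_ball_finite_distrib[OF finite_simple_roots] filterlim_at_top)
      moreover have "\<forall>\<^sub>F l in sequentially. flag_point D (\<kappa> l) \<in> U n"
        using x(5) U \<eta>(2) by (simp add: limitin_def)
      ultimately have "\<forall>\<^sub>F l in sequentially. (\<forall>\<alpha>\<in>simple_roots D. \<alpha> (cartan_projection D (x l)) \<ge> real n)
          \<and> flag_point D (\<kappa> l) \<in> U n" by (rule eventually_conj)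
      then obtain l where "\<forall>\<alpha>\<in>simple_roots D. \<alpha> (cartan_projection D (x l)) \<ge> real n"
          "flag_point D (\<kappa> l) \<in> U n"
        using eventually_happens trivial_limit_sequentially by blast
      then show ?thesis using x(1,3,4) by blast
    qed
    then obtain x \<kappa> where x: "\<And>n. x n \<in> \<Delta>"
        "\<And>n \<alpha>. \<alpha> \<in> simple_roots D \<Longrightarrow> \<alpha> (cartan_projection D (x n)) \<ge> real n"
        "\<And>n. \<kappa> n \<in> Kgrp D" "\<And>n. \<exists>v\<in>aplus D. \<exists>k\<in>Kgrp D. x n = \<kappa> n ** mexp v ** k"
        "\<And>n. flag_point D (\<kappa> n) \<in> U n"
      by metis
    have "limitin ?X (\<lambda>n. flag_point D (\<kappa> n)) \<xi> sequentially"
      unfolding limitin_def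
    proof (intro conjI allI impI)
      show "\<xi> \<in> topspace ?X" by fact
      fix W assume W: "openin ?X W \<and> \<xi> \<in> W"
      then have "openin (top_of_set (Grp D)) {h \<in> Grp D. flag_point D h \<in> W}"
        by (auto simp: openin_flag_topology flag_openin_def)
      then obtain e where e: "e > 0" "Grp D \<inter> ball g e \<subseteq> {h \<in> Grp D. flag_point D h \<in> W}"
        using W g by (auto simp: openin_contains_ball Int_commute)
      obtain N where N: "inverse (real (Suc N)) < e" using e(1) reals_Archimedean by blast
      have "U n \<subseteq> W" if "n \<ge> N" for n
      proof -
        have "inverse (real (Suc n)) \<le> inverse (real (Suc N))" using that by simp
        then have "ball g (inverse (real (Suc n))) \<subseteq> ball g e" using N by (intro subset_ball) linarith
        then show ?thesis unfolding U_def using e(2) by blast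
      qed
      then show "\<forall>\<^sub>F n in sequentially. flag_point D (\<kappa> n) \<in> W"
        using x(5) by (auto simp: eventually_sequentially)
    qed
    moreover have "filterlim (\<lambda>n. \<alpha> (cartan_projection D (x n))) at_top sequentially"
      if "\<alpha> \<in> simple_roots D" for \<alpha>
      by (rule filterlim_at_top_mono[OF filterlim_real_sequentially]) (simp add: x(2)[OF that])
    ultimately show ?thesis
      unfolding limit_set_def converges_to_flag_def using x(1,3,4) by blast
  qed
  then show ?thesis
    using closure_of_subset_eq limit_set_subset_topspace by blast
qed

section \<open>Push-forwards and Radon-Nikodym cocycles\<close>

lemma sets_borel_of: "sets (borel_of X) = sigma_sets (topspace X) {U. openin X U}"
  unfolding borel_of_def by (rule sets_measure_of) (auto dest: openin_subset)

lemma space_borel_of: "space (borel_of X) = topspace X"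
  unfolding borel_of_def by (rule space_measure_of) (auto dest: openin_subset)

lemma openin_sets_borel_of: "openin X U \<Longrightarrow> U \<in> sets (borel_of X)"
  by (simp add: sets_borel_of)

lemma closedin_sets_borel_of:
  assumes "closedin X C"
  shows "C \<in> sets (borel_of X)"
proof -
  have "space (borel_of X) - (topspace X - C) \<in> sets (borel_of X)"
    using assms by (intro sets.compl_sets openin_sets_borel_of) (auto simp: closedin_def)
  then show ?thesis
    using closedin_subset[OF assms] by (simp add: space_borel_of double_diff)
qed

text \<open>A relatively open preimage is the trace on \<open>S\<close> of an open set of
  \<open>X\<close>, hence lies in the restricted Borel algebra; open sets generate the target, so
  testing them suffices.\<close>

lemma measurable_borel_of_subtopology:
  assumes h: "continuous_map (subtopology X S) Y h" and M: "sets M = sets (borel_of X)"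
  shows "h \<in> measurable (restrict_space M S) (borel_of Y)"
proof (rule measurable_sigma_sets[OF sets_borel_of])
  have sp: "space (restrict_space M S) = topspace (subtopology X S)"
    using sets_eq_imp_space_eq[OF M] by (auto simp: space_restrict_space space_borel_of)
  show "{U. openin Y U} \<subseteq> Pow (topspace Y)" by (auto dest: openin_subset)
  show "h \<in> space (restrict_space M S) \<rightarrow> topspace Y"
    unfolding sp using h by (auto simp: continuous_map_def)
  fix U assume "U \<in> {U. openin Y U}"
  then have "openin (subtopology X S) {x \<in> topspace (subtopology X S). h x \<in> U}"
    using h by (auto simp: continuous_map_def)
  then obtain T where "openin X T" "{x \<in> topspace (subtopology X S). h x \<in> U} = T \<inter> S"
    by (auto simp: openin_subtopology)
  moreover have "h -` U \<inter> space (restrict_space M S) = {x \<in> topspace (subtopology X S). h x \<in> U}"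
    unfolding sp by auto
  ultimately show "h -` U \<inter> space (restrict_space M S) \<in> sets (restrict_space M S)"
    using M by (auto simp: sets_restrict_space openin_sets_borel_of)
qed

lemma measurable_borel_of:
  "continuous_map X Y h \<Longrightarrow> sets M = sets (borel_of X) \<Longrightarrow> h \<in> measurable M (borel_of Y)"
  using measurable_borel_of_subtopology[of X UNIV Y h M] by simp

text \<open>Replaces a map defined on \<open>S\<close> by a total one with the constant value
  \<open>c\<close> elsewhere, so that the usual rules for images and densities apply; the two agree
  almost everywhere. The default lies in the target space to keep the extension measurable.\<close>

lemma distr_restrict_space_full:
  assumes S: "S \<in> sets M" "AE x in M. x \<in> S" and h: "h \<in> measurable (restrict_space M S) N"
    and c: "c \<in> space N"
  shows "distr (restrict_space M S) N h = distr M N (\<lambda>x. if x \<in> S then h x else c)"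
proof (rule measure_eqI)
  have S': "S \<inter> space M \<in> sets M" using S by auto
  have m: "(\<lambda>x. if x \<in> S then h x else c) \<in> measurable M N"
    using measurable_restrict_space_iff[OF S' c] h by blast
  fix A assume "A \<in> sets (distr (restrict_space M S) N h)"
  then have A: "A \<in> sets N" by simp
  have "emeasure (distr (restrict_space M S) N h) A = emeasure M (h -` A \<inter> space (restrict_space M S))"
    by (subst emeasure_distr[OF h A], rule emeasure_restrict_space[OF S']) (auto simp: space_restrict_space)
  also have "\<dots> = emeasure M ((\<lambda>x. if x \<in> S then h x else c) -` A \<inter> space M)"
  proof (rule emeasure_eq_AE)
    show "AE x in M. x \<in> h -` A \<inter> space (restrict_space M S) \<longleftrightarrow>
        x \<in> (\<lambda>x. if x \<in> S then h x else c) -` A \<inter> space M"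
      using S(2) by eventually_elim (auto simp: space_restrict_space)
    show "h -` A \<inter> space (restrict_space M S) \<in> sets M"
      using measurable_sets[OF h A] S(1) by (auto simp: sets_restrict_space)
    show "(\<lambda>x. if x \<in> S then h x else c) -` A \<inter> space M \<in> sets M"
      using measurable_sets[OF m A] .
  qed
  also have "\<dots> = emeasure (distr M N (\<lambda>x. if x \<in> S then h x else c)) A"
    by (rule emeasure_distr[OF m A, symmetric])
  finally show "emeasure (distr (restrict_space M S) N h) A = \<dots>" .
qed simp

lemma prob_space_distr_restrict_space:
  assumes "prob_space M" "S \<in> sets M" "AE x in M. x \<in> S" "h \<in> measurable (restrict_space M S) N"
  shows "prob_space (distr (restrict_space M S) N h)"
proof -
  interpret prob_space M by fact
  have "emeasure M S = 1" using assms(2,3) emeasure_eq_1_AE by blast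
  then have "prob_space (restrict_space M S)"
    using assms(2) by (intro prob_space_restrict_space)
  then show ?thesis by (rule prob_space.prob_space_distr[OF _ assms(4)])
qed

lemma AE_distr_restrict_space:
  assumes S: "S \<in> sets M" "AE x in M. x \<in> S" and h: "h \<in> measurable (restrict_space M S) N"
    and P: "{x \<in> space N. P x} \<in> sets N"
  shows "(AE x in distr (restrict_space M S) N h. P x) \<longleftrightarrow> (AE x in M. x \<in> S \<longrightarrow> P (h x))"
proof -
  have "S \<inter> space M \<in> sets M" using S by auto
  then show ?thesis by (simp add: AE_distr_iff[OF h P] AE_restrict_space_iff)
qed

text \<open>Since \<open>h\<close> intertwines \<open>t\<close> and \<open>T\<close> almost
  everywhere, the image of \<mu> under \<open>T\<close> is the image under \<open>h\<close> of the
  measure with density \<open>c\<close>; as \<open>c\<close> factors through \<open>h\<close> on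
  \<open>S\<close>, that measure has density \<open>C\<close> over \<mu>.\<close>

lemma distr_push_density:
  assumes \<nu>: "prob_space \<nu>" and S: "S \<in> sets \<nu>" "AE x in \<nu>. x \<in> S"
    and h: "h \<in> measurable (restrict_space \<nu> S) N"
    and t: "t \<in> measurable \<nu> \<nu>" "distr \<nu> \<nu> t = density \<nu> c" and c: "c \<in> borel_measurable \<nu>"
    and T: "T \<in> measurable N N" "AE x in \<nu>. x \<in> S \<longrightarrow> t x \<in> S \<and> h (t x) = T (h x)"
    and C: "C \<in> borel_measurable N" "\<And>x. x \<in> S \<Longrightarrow> C (h x) = c x"
  defines "\<mu> \<equiv> distr (restrict_space \<nu> S) N h"
  shows "distr \<mu> \<mu> T = density \<mu> C"
proof -
  interpret prob_space \<nu> by fact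
  \<comment> \<open>A probability measure cannot be concentrated on the empty set; the image of
    \<open>s\<close> becomes the default value of the total extension \<open>h'\<close>.\<close>
  obtain s where s: "s \<in> S" using S(2) AE_False by (cases "S = {}") auto
  then have "s \<in> space (restrict_space \<nu> S)"
    using S(1) sets.sets_into_space by (auto simp: space_restrict_space)
  then have hs: "h s \<in> space N" using h measurable_space by metis
  define h' where "h' = (\<lambda>x. if x \<in> S then h x else h s)"
  have \<mu>: "\<mu> = distr \<nu> N h'"
    unfolding \<mu>_def h'_def by (rule distr_restrict_space_full[OF S h hs])
  have S': "S \<inter> space \<nu> \<in> sets \<nu>" using S by auto
  then have h': "h' \<in> measurable \<nu> N"
    unfolding h'_def using measurable_restrict_space_iff[OF S' hs, of h] h by simp
  have "distr \<mu> \<mu> T = distr \<mu> N T" by (rule distr_cong) (auto simp: \<mu>)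
  also have "\<dots> = distr \<nu> N (T \<circ> h')" unfolding \<mu> by (rule distr_distr[OF T(1) h'])
  also have "\<dots> = distr \<nu> N (h' \<circ> t)"
  proof (rule distr_cong_AE)
    show "AE x in \<nu>. (T \<circ> h') x = (h' \<circ> t) x"
      using S(2) T(2) by eventually_elim (auto simp: h'_def)
  qed (auto intro: measurable_comp h' T(1) t(1))
  also have "\<dots> = distr (density \<nu> c) N h'" by (simp add: distr_distr[OF h' t(1)] flip: t(2))
  also have "density \<nu> c = density \<nu> (\<lambda>x. C (h' x))"
  proof (rule density_cong)
    show "AE x in \<nu>. c x = C (h' x)" using S(2) by eventually_elim (auto simp: h'_def C(2))
  qed (use c C(1) h' in \<open>auto intro: measurable_compose\<close>)
  also have "distr \<dots> N h' = density \<mu> C"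
    unfolding \<mu> by (rule density_distr[OF C(1) h', symmetric])
  finally show ?thesis .
qed

text \<open>The image of \<sigma> under \<open>T\<close> is written as a density over \<mu> in two
  ways: by transporting \<phi> through the left inverse \<open>T'\<close>, and by the transformation
  rule for \<sigma>. Densities over a sigma-finite measure are unique almost everywhere.\<close>

lemma density_cocycle:
  assumes \<mu>: "sigma_finite_measure \<mu>" and \<phi>: "\<phi> \<in> borel_measurable \<mu>" "\<sigma> = density \<mu> \<phi>"
    and T: "T \<in> measurable \<mu> \<mu>" "T' \<in> measurable \<mu> \<mu>" "\<And>x. x \<in> space \<mu> \<Longrightarrow> T' (T x) = x"
    and a: "a \<in> borel_measurable \<mu>" "distr \<mu> \<mu> T = density \<mu> a"
    and b: "b \<in> borel_measurable \<mu>" "distr \<sigma> \<sigma> T = density \<sigma> b"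
  shows "AE x in \<mu>. \<phi> (T' x) * a x = \<phi> x * b x"
proof -
  interpret sigma_finite_measure \<mu> by fact
  have m: "(\<lambda>x. \<phi> (T' x)) \<in> borel_measurable \<mu>" using T(2) \<phi>(1) by (rule measurable_compose)
  have "density \<mu> (\<lambda>x. a x * \<phi> (T' x)) = density (distr \<mu> \<mu> T) (\<lambda>x. \<phi> (T' x))"
    unfolding a(2) by (rule density_density_eq[OF a(1) m, symmetric])
  also have "\<dots> = distr (density \<mu> (\<lambda>x. \<phi> (T' (T x)))) \<mu> T"
    by (rule density_distr[OF m T(1)])
  also have "density \<mu> (\<lambda>x. \<phi> (T' (T x))) = \<sigma>"
    unfolding \<phi>(2) using T(3) \<phi>(1) measurable_compose[OF T(1) m] by (intro density_cong) simp_all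
  also have "distr \<sigma> \<mu> T = distr \<sigma> \<sigma> T" by (rule distr_cong) (auto simp: \<phi>(2))
  also have "\<dots> = density \<mu> (\<lambda>x. \<phi> x * b x)"
    unfolding b(2) unfolding \<phi>(2) by (rule density_density_eq[OF \<phi>(1) b(1)])
  finally have "density \<mu> (\<lambda>x. a x * \<phi> (T' x)) = density \<mu> (\<lambda>x. \<phi> x * b x)" .
  then have "AE x in \<mu>. a x * \<phi> (T' x) = \<phi> x * b x"
    using a(1) b(1) m \<phi>(1) by (subst density_unique_iff[symmetric]) simp_all
  then show ?thesis by (simp add: mult.commute)
qed

text \<open>The integer part of \<open>ln (\<phi> x) / \<epsilon>\<close> splits the set where
  \<phi> is positive into countably many level sets; if all were null, the density would define the
  zero measure.\<close>

lemma density_slice: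
  fixes \<phi> :: "'a \<Rightarrow> real"
  assumes \<phi>: "\<phi> \<in> borel_measurable \<mu>" and ne: "emeasure (density \<mu> (\<lambda>x. ennreal (\<phi> x))) (space \<mu>) \<noteq> 0"
    and e: "\<epsilon> > 0"
  obtains B where "B \<in> sets \<mu>" "emeasure \<mu> B > 0" "\<And>x. x \<in> B \<Longrightarrow> \<phi> x > 0"
    "\<And>x y. x \<in> B \<Longrightarrow> y \<in> B \<Longrightarrow> \<bar>ln (\<phi> x) - ln (\<phi> y)\<bar> < \<epsilon>"
proof -
  note [measurable] = \<phi>
  define B where "B n = {x \<in> space \<mu>. 0 < \<phi> x \<and> \<lfloor>ln (\<phi> x) / \<epsilon>\<rfloor> = n}" for n :: int
  have B[measurable]: "B n \<in> sets \<mu>" for n unfolding B_def by measurable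
  have "\<exists>n. emeasure \<mu> (B n) \<noteq> 0"
  proof (rule ccontr)
    assume "\<not> ?thesis"
    then have "B n \<in> null_sets \<mu>" for n using B by (auto simp: null_sets_def)
    then have "(\<Union>n. B n) \<in> null_sets \<mu>" by (rule null_sets_UN)
    then have "AE x in \<mu>. x \<notin> (\<Union>n. B n)" by (rule AE_not_in)
    then have "AE x in \<mu>. ennreal (\<phi> x) = 0"
      using AE_space by eventually_elim (auto simp: B_def ennreal_eq_0_iff not_less)
    then have "emeasure (density \<mu> (\<lambda>x. ennreal (\<phi> x))) (space \<mu>) = 0"
      by (simp add: emeasure_density nn_integral_0_iff_AE)
    then show False using ne by simp
  qed
  then obtain n where n: "emeasure \<mu> (B n) \<noteq> 0" by blast
  show thesis
  proof (rule that[OF B])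
    show "emeasure \<mu> (B n) > 0" using n by (simp add: zero_less_iff_neq_zero)
    show "\<phi> x > 0" if "x \<in> B n" for x using that by (simp add: B_def)
    fix x y assume "x \<in> B n" "y \<in> B n"
    then have "\<lfloor>ln (\<phi> x) / \<epsilon>\<rfloor> = \<lfloor>ln (\<phi> y) / \<epsilon>\<rfloor>" by (simp add: B_def)
    moreover have "\<bar>p - q\<bar> < 1" if "\<lfloor>p\<rfloor> = \<lfloor>q\<rfloor>" for p q :: real using that by linarith
    ultimately have "\<bar>ln (\<phi> x) / \<epsilon> - ln (\<phi> y) / \<epsilon>\<bar> < 1" by blast
    then have "\<bar>(ln (\<phi> x) - ln (\<phi> y)) / \<epsilon>\<bar> < 1" by (simp only: diff_divide_distrib)
    then have "\<bar>ln (\<phi> x) - ln (\<phi> y)\<bar> / \<epsilon> < 1" using e by (simp only: abs_divide abs_of_pos)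
    then show "\<bar>ln (\<phi> x) - ln (\<phi> y)\<bar> < \<epsilon>" using e by simp
  qed
qed

text \<open>\<open>B\<close> is a set on which the logarithm of the density of \<open>\<sigma>\<close> varies by less than \<open>\<epsilon>\<close>.\<close>

lemma absolutely_continuous_cocycles_close:
  fixes T T' :: "'i \<Rightarrow> 'a \<Rightarrow> 'a" and a b :: "'i \<Rightarrow> 'a \<Rightarrow> real"
  assumes \<mu>: "prob_space \<mu>" and \<sigma>: "prob_space \<sigma>" "sets \<sigma> = sets \<mu>" and ac: "absolutely_continuous \<mu> \<sigma>"
    and T: "\<And>g. g \<in> I \<Longrightarrow> T g \<in> measurable \<mu> \<mu>" "\<And>g. g \<in> I \<Longrightarrow> T' g \<in> measurable \<mu> \<mu>"
      "\<And>g x. g \<in> I \<Longrightarrow> x \<in> space \<mu> \<Longrightarrow> T' g (T g x) = x"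
    and a: "\<And>g. g \<in> I \<Longrightarrow> a g \<in> borel_measurable \<mu>"
      "\<And>g. g \<in> I \<Longrightarrow> distr \<mu> \<mu> (T g) = density \<mu> (\<lambda>x. ennreal (exp (a g x)))"
    and b: "\<And>g. g \<in> I \<Longrightarrow> b g \<in> borel_measurable \<mu>"
      "\<And>g. g \<in> I \<Longrightarrow> distr \<sigma> \<sigma> (T g) = density \<sigma> (\<lambda>x. ennreal (exp (b g x)))"
    and e: "\<epsilon> > 0"
  obtains B where "B \<in> sets \<mu>" "emeasure \<mu> B > 0"
    "\<And>g. g \<in> I \<Longrightarrow> AE x in \<mu>. x \<in> B \<inter> T g ` B \<longrightarrow> \<bar>a g x - b g x\<bar> < \<epsilon>"
proof -
  interpret M: prob_space \<mu> by fact
  interpret N: prob_space \<sigma> by fact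
  \<comment> \<open>A real-valued version of the derivative, since logarithms are taken;
    sigma-finiteness of \<sigma> makes the derivative finite almost everywhere.\<close>
  define \<phi> where "\<phi> x = enn2real (RN_deriv \<mu> \<sigma> x)" for x
  have \<phi>[measurable]: "\<phi> \<in> borel_measurable \<mu>" unfolding \<phi>_def by measurable
  have "AE x in \<mu>. RN_deriv \<mu> \<sigma> x \<noteq> \<infinity>"
    using M.RN_deriv_finite[OF N.sigma_finite_measure_axioms ac \<sigma>(2)] .
  then have "AE x in \<mu>. ennreal (\<phi> x) = RN_deriv \<mu> \<sigma> x"
    by eventually_elim (simp add: \<phi>_def less_top)
  then have "density \<mu> (\<lambda>x. ennreal (\<phi> x)) = density \<mu> (RN_deriv \<mu> \<sigma>)"
    by (intro density_cong) auto
  then have \<sigma>\<phi>: "\<sigma> = density \<mu> (\<lambda>x. ennreal (\<phi> x))"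
    using M.density_RN_deriv[OF ac \<sigma>(2)] by simp
  have "emeasure \<sigma> (space \<mu>) \<noteq> 0"
    using N.emeasure_space_1 sets_eq_imp_space_eq[OF \<sigma>(2)] by simp
  then obtain B where B: "B \<in> sets \<mu>" "emeasure \<mu> B > 0" "\<And>x. x \<in> B \<Longrightarrow> \<phi> x > 0"
    "\<And>x y. x \<in> B \<Longrightarrow> y \<in> B \<Longrightarrow> \<bar>ln (\<phi> x) - ln (\<phi> y)\<bar> < \<epsilon>"
    using density_slice[OF \<phi> _ e] \<sigma>\<phi> by metis
  show thesis
  proof (rule that[OF B(1,2)])
    fix g assume g: "g \<in> I"
    note [measurable] = a(1)[OF g] b(1)[OF g]
    have "AE x in \<mu>. ennreal (\<phi> (T' g x)) * ennreal (exp (a g x)) = ennreal (\<phi> x) * ennreal (exp (b g x))"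
      by (rule density_cocycle[OF M.sigma_finite_measure_axioms _ \<sigma>\<phi> T(1)[OF g] T(2)[OF g] T(3)[OF g]
            _ a(2)[OF g] _ b(2)[OF g]]) measurable
    then show "AE x in \<mu>. x \<in> B \<inter> T g ` B \<longrightarrow> \<bar>a g x - b g x\<bar> < \<epsilon>"
    proof (eventually_elim, safe)
      \<comment> \<open>A return to \<open>B\<close> is a point \<open>T g y\<close> with both it
        and \<open>y\<close> in \<open>B\<close>. Both density values are then positive, so the
        multiplicative relation has a logarithm, and their logarithms differ by less than
        \<epsilon>.\<close>
      fix y assume eq: "ennreal (\<phi> (T' g (T g y))) * ennreal (exp (a g (T g y))) =
          ennreal (\<phi> (T g y)) * ennreal (exp (b g (T g y)))"
        and x: "T g y \<in> B" and y: "y \<in> B"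
      have y': "T' g (T g y) = y" using T(3)[OF g] y B(1) sets.sets_into_space by blast
      have "\<phi> y * exp (a g (T g y)) = \<phi> (T g y) * exp (b g (T g y))"
        using eq B(3)[OF x] B(3)[OF y] unfolding y' by (simp add: flip: ennreal_mult)
      then have "ln (\<phi> y * exp (a g (T g y))) = ln (\<phi> (T g y) * exp (b g (T g y)))" by simp
      then have "ln (\<phi> y) + a g (T g y) = ln (\<phi> (T g y)) + b g (T g y)"
        using B(3)[OF x] B(3)[OF y] by (simp add: ln_mult)
      then show "\<bar>a g (T g y) - b g (T g y)\<bar> < \<epsilon>" using B(4)[OF x y] by linarith
    qed
  qed
qed

text \<open>The image of \<nu> under \<open>t\<close> is absolutely continuous with respect to
  \<nu>, so \<open>t\<close> pulls the null complement of \<open>S\<close> back to a null set. This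
  supplies invariance of a limit set up to a null set.\<close>

lemma AE_distr_density_invariant:
  assumes t: "t \<in> measurable \<nu> \<nu>" "distr \<nu> \<nu> t = density \<nu> c" and c: "c \<in> borel_measurable \<nu>"
    and S: "S \<in> sets \<nu>" "AE x in \<nu>. x \<in> S"
  shows "AE x in \<nu>. t x \<in> S"
proof -
  have "AE x in density \<nu> c. x \<in> S"
    using S(2) by (subst AE_density[OF c]) (auto elim: eventually_mono)
  then have "AE x in distr \<nu> \<nu> t. x \<in> S" unfolding t(2) .
  moreover have "{x \<in> space \<nu>. x \<in> S} \<in> sets \<nu>"
    using S(1) sets.sets_into_space[OF S(1)] by (simp add: Collect_conj_eq Int_absorb1 Int_commute inf.absorb1)
  ultimately show ?thesis by (simp add: AE_distr_iff[OF t(1)])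
qed

section \<open>Singularity of the conformal measures\<close>

lemma measurable_flag_action:
  assumes "connected_real_algebraic_group (Grp D)" "g \<in> Grp D"
    and "sets \<nu> = sets (borel_of (flag_topology D))"
  shows "flag_action g \<in> measurable \<nu> \<nu>"
  using measurable_borel_of[OF continuous_map_flag_action[OF assms(1,2)] assms(3)]
    measurable_cong_sets[OF refl assms(3)] by blast

lemma continuous_map_prod_flag_action:
  assumes "connected_real_algebraic_group (Grp D1)" "connected_real_algebraic_group (Grp D2)"
    and "fst g \<in> Grp D1" "snd g \<in> Grp D2"
  shows "continuous_map (prod_flag_topology D1 D2) (prod_flag_topology D1 D2) (prod_flag_action g)"
  unfolding prod_flag_action_def[abs_def] prod_flag_topology_def
  by (intro continuous_map_pairedI
      continuous_map_compose[OF continuous_map_fst continuous_map_flag_action, unfolded comp_def]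
      continuous_map_compose[OF continuous_map_snd continuous_map_flag_action, unfolded comp_def] assms)

lemma measurable_prod_flag_topology:
  assumes "sets M = sets (borel_of (prod_flag_topology D1 D2))"
  shows "fst \<in> measurable M (borel_of (flag_topology D1))"
    and "snd \<in> measurable M (borel_of (flag_topology D2))"
  using assms unfolding prod_flag_topology_def
  by (auto intro!: measurable_borel_of continuous_map_fst continuous_map_snd)

text \<open>The inverse homeomorphism agrees with \<open>inv_into S f\<close> on the image, so this
  encoding of the inverse boundary map inherits continuity there.\<close>

lemma embedding_map_inv_into:
  assumes f: "embedding_map (subtopology X S) Y f" and S: "S \<subseteq> topspace X"
  shows "continuous_map (subtopology X S) Y f" "inj_on f S"
    and "continuous_map (subtopology Y (f ` S)) (subtopology X S) (inv_into S f)"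
proof -
  have tS: "topspace (subtopology X S) = S" using S by auto
  then have hom: "homeomorphic_map (subtopology X S) (subtopology Y (f ` S)) f"
    using f by (simp add: embedding_map_def)
  then show inj: "inj_on f S" using homeomorphic_imp_injective_map tS by metis
  show "continuous_map (subtopology X S) Y f"
    using hom homeomorphic_imp_continuous_map continuous_map_in_subtopology by blast
  obtain g where g: "homeomorphic_maps (subtopology X S) (subtopology Y (f ` S)) f g"
    using hom homeomorphic_map_maps by blast
  show "continuous_map (subtopology Y (f ` S)) (subtopology X S) (inv_into S f)"
  proof (rule continuous_map_eq)
    show "continuous_map (subtopology Y (f ` S)) (subtopology X S) g"
      using g by (simp add: homeomorphic_maps_def)
    fix y assume "y \<in> topspace (subtopology Y (f ` S))"
    then obtain x where "x \<in> S" "y = f x" by auto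
    then show "g y = inv_into S f y"
      using g inj tS by (simp add: homeomorphic_maps_def)
  qed
qed

theorem proposition1p7:
  fixes G1 :: "('n::finite) cartan_group" and G2 :: "('m::finite) cartan_group"
    and nrm :: "'n mat \<times> 'm mat \<Rightarrow> real"
    and \<Gamma> :: "'n mat set" and \<rho> :: "'n mat \<Rightarrow> 'm mat"
    and f :: "'n mat set \<Rightarrow> 'm mat set"
    and \<psi>1 :: "'n mat \<Rightarrow> real" and \<psi>2 :: "'m mat \<Rightarrow> real"
    and \<nu>1 :: "'n mat set measure" and \<nu>2 :: "'m mat set measure"
  defines "\<Lambda> \<equiv> limit_set G1 \<Gamma>"
    and "\<Lambda>\<rho> \<equiv> limit_set G2 (\<rho> ` \<Gamma>)"
  defines "id_f_\<nu>1 \<equiv> push_measure \<nu>1 \<Lambda> (prod_flag_topology G1 G2) (\<lambda>\<xi>. (\<xi>, f \<xi>))"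
    and "finv_id_\<nu>2 \<equiv> push_measure \<nu>2 \<Lambda>\<rho> (prod_flag_topology G1 G2) (\<lambda>\<eta>. (inv_into \<Lambda> f \<eta>, \<eta>))"
    and "f_\<nu>1 \<equiv> push_measure \<nu>1 \<Lambda> (flag_topology G2) f"
  assumes G1: "connected_simple_real_algebraic_group (Grp G1)" "\<not> compact (Grp G1)"
      "cartan_group G1"
    and G2: "connected_simple_real_algebraic_group (Grp G2)" "\<not> compact (Grp G2)"
      "cartan_group G2"
    and nrm: "weyl_invariant_norm G1 G2 nrm"
    and \<Gamma>: "subgroup \<Gamma> (GL\<lparr>carrier := Grp G1\<rparr>)" "discrete \<Gamma>" "zariski_dense_in \<Gamma> (Grp G1)"
    and \<rho>: "\<rho> \<in> hom (GL\<lparr>carrier := \<Gamma>\<rparr>) (GL\<lparr>carrier := Grp G2\<rparr>)" "inj_on \<rho> \<Gamma>"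
      "discrete (\<rho> ` \<Gamma>)" "zariski_dense_in (\<rho> ` \<Gamma>) (Grp G2)"
    and f: "boundary_map G1 G2 \<Gamma> \<rho> f" "f ` \<Lambda> = \<Lambda>\<rho>"
    and \<psi>: "\<psi>1 \<in> dual_space (alie G1)" "\<psi>2 \<in> dual_space (alie G2)"
    and \<nu>1: "conformal_measure G1 \<Gamma> \<psi>1 \<nu>1" "AE \<xi> in \<nu>1. \<xi> \<in> \<Lambda>"
    and \<nu>2: "conformal_measure G2 (\<rho> ` \<Gamma>) \<psi>2 \<nu>2" "AE \<eta> in \<nu>2. \<eta> \<in> \<Lambda>\<rho>"
    and ess: "\<not> essential_subgroup G1 G2 nrm id_f_\<nu>1 (self_joining \<Gamma> \<rho>)
        \<subseteq> {(u1, u2). u1 \<in> alie G1 \<and> u2 \<in> alie G2 \<and> \<psi>1 u1 = \<psi>2 u2}"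
  shows "\<not> absolutely_continuous id_f_\<nu>1 finv_id_\<nu>2 \<and> \<not> absolutely_continuous f_\<nu>1 \<nu>2"
proof -

  \<comment> \<open>Conformality, limit sets and the boundary map\<close>
  let ?X1 = "flag_topology G1" and ?X2 = "flag_topology G2"
  define N where "N = borel_of (prod_flag_topology G1 G2)"
  let ?h1 = "\<lambda>\<xi>. (\<xi>, f \<xi>)" and ?h2 = "\<lambda>\<eta>. (inv_into \<Lambda> f \<eta>, \<eta>)"
  have alg: "connected_real_algebraic_group (Grp G1)" "connected_real_algebraic_group (Grp G2)"
    using G1(1) G2(1) by (auto simp: connected_simple_real_algebraic_group_def)
  have sub: "subspace (alie G1)" "subspace (alie G2)"
    using G1(3) G2(3) by (auto simp: cartan_group_def maximal_abelian_in_def)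
  have \<Gamma>G: "\<gamma> \<in> Grp G1" "\<rho> \<gamma> \<in> Grp G2" if "\<gamma> \<in> \<Gamma>" for \<gamma>
    using subgroup.subset[OF \<Gamma>(1)] \<rho>(1) that by (auto simp: hom_def)
  have s: "sets \<nu>1 = sets (borel_of ?X1)" "sets \<nu>2 = sets (borel_of ?X2)"
    and P: "prob_space \<nu>1" "prob_space \<nu>2"
    using \<nu>1(1) \<nu>2(1) by (auto simp: conformal_measure_def)
  have RN1: "(\<lambda>\<eta>. exp (\<psi>1 (busemann G1 \<eta> (mat 1) \<gamma>))) \<in> borel_measurable \<nu>1"
    "distr \<nu>1 \<nu>1 (flag_action \<gamma>) = density \<nu>1 (\<lambda>\<eta>. ennreal (exp (\<psi>1 (busemann G1 \<eta> (mat 1) \<gamma>))))"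
    if "\<gamma> \<in> \<Gamma>" for \<gamma>
    using \<nu>1(1) that by (auto simp: conformal_measure_def has_RN_derivative_def)
  have RN2: "(\<lambda>\<eta>. exp (\<psi>2 (busemann G2 \<eta> (mat 1) (\<rho> \<gamma>)))) \<in> borel_measurable \<nu>2"
    "distr \<nu>2 \<nu>2 (flag_action (\<rho> \<gamma>)) = density \<nu>2 (\<lambda>\<eta>. ennreal (exp (\<psi>2 (busemann G2 \<eta> (mat 1) (\<rho> \<gamma>)))))"
    if "\<gamma> \<in> \<Gamma>" for \<gamma>
    using \<nu>2(1) that by (auto simp: conformal_measure_def has_RN_derivative_def)
  have S: "\<Lambda> \<in> sets \<nu>1" "\<Lambda>\<rho> \<in> sets \<nu>2"
    unfolding s \<Lambda>_def \<Lambda>\<rho>_def by (intro closedin_sets_borel_of closedin_limit_set alg)+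
  have emb: "embedding_map (subtopology ?X1 \<Lambda>) ?X2 f"
    and equi: "\<And>\<gamma> \<xi>. \<gamma> \<in> \<Gamma> \<Longrightarrow> \<xi> \<in> \<Lambda> \<Longrightarrow> f (flag_action \<gamma> \<xi>) = flag_action (\<rho> \<gamma>) (f \<xi>)"
    using f(1) by (auto simp: boundary_map_def \<Lambda>_def)
  have \<Lambda>top: "\<Lambda> \<subseteq> topspace ?X1" unfolding \<Lambda>_def by (rule limit_set_subset_topspace)
  note cont_f = embedding_map_inv_into(1)[OF emb \<Lambda>top]
    and inj_f = embedding_map_inv_into(2)[OF emb \<Lambda>top]
    and cont_inv = embedding_map_inv_into(3)[OF emb \<Lambda>top, unfolded f(2)]
  have inv_f: "inv_into \<Lambda> f \<eta> \<in> \<Lambda>" "f (inv_into \<Lambda> f \<eta>) = \<eta>" if "\<eta> \<in> \<Lambda>\<rho>" for \<eta>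
    using that f(2) by (auto simp: inv_into_into f_inv_into_f)
  have h1: "?h1 \<in> measurable (restrict_space \<nu>1 \<Lambda>) N"
    unfolding N_def prod_flag_topology_def
    by (intro measurable_borel_of_subtopology[OF _ s(1)] continuous_map_pairedI cont_f
        continuous_map_from_subtopology continuous_map_id[unfolded id_def])
  have h2: "?h2 \<in> measurable (restrict_space \<nu>2 \<Lambda>\<rho>) N"
    unfolding N_def prod_flag_topology_def
    by (intro measurable_borel_of_subtopology[OF _ s(2)] continuous_map_pairedI
        continuous_map_into_fulltopology[OF cont_inv]
        continuous_map_from_subtopology[OF continuous_map_id[unfolded id_def]])
  have fm: "f \<in> measurable (restrict_space \<nu>1 \<Lambda>) (borel_of ?X2)"
    by (rule measurable_borel_of_subtopology[OF cont_f s(1)])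

  \<comment> \<open>The two push-forwards on the product\<close>
  define \<mu> where "\<mu> = distr (restrict_space \<nu>1 \<Lambda>) N ?h1"
  define \<sigma> where "\<sigma> = distr (restrict_space \<nu>2 \<Lambda>\<rho>) N ?h2"
  have eqs: "id_f_\<nu>1 = \<mu>" "finv_id_\<nu>2 = \<sigma>" "f_\<nu>1 = distr (restrict_space \<nu>1 \<Lambda>) (borel_of ?X2) f"
    by (simp_all add: id_f_\<nu>1_def finv_id_\<nu>2_def f_\<nu>1_def push_measure_def \<mu>_def \<sigma>_def N_def)
  have sets_\<mu>: "sets \<mu> = sets N" "sets \<sigma> = sets N" by (simp_all add: \<mu>_def \<sigma>_def)
  have prob: "prob_space \<mu>" "prob_space \<sigma>"
    unfolding \<mu>_def \<sigma>_def
    using prob_space_distr_restrict_space[OF P(1) S(1) \<nu>1(2) h1]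
      prob_space_distr_restrict_space[OF P(2) S(2) \<nu>2(2) h2] by auto
  have fstN: "fst \<in> measurable N \<nu>1" and sndN: "snd \<in> measurable N \<nu>2"
    using measurable_prod_flag_topology[of N G1 G2] measurable_cong_sets[OF refl s(1)]
      measurable_cong_sets[OF refl s(2)] by (auto simp: N_def)
  have tm1: "flag_action \<gamma> \<in> measurable \<nu>1 \<nu>1" if "\<gamma> \<in> \<Gamma>" for \<gamma>
    by (rule measurable_flag_action[OF alg(1) \<Gamma>G(1)[OF that] s(1)])
  have tm2: "flag_action (\<rho> \<gamma>) \<in> measurable \<nu>2 \<nu>2" if "\<gamma> \<in> \<Gamma>" for \<gamma>
    by (rule measurable_flag_action[OF alg(2) \<Gamma>G(2)[OF that] s(2)])
  have TN: "prod_flag_action g \<in> measurable N N" if "fst g \<in> Grp G1" "snd g \<in> Grp G2" for g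
    unfolding N_def by (rule measurable_borel_of[OF continuous_map_prod_flag_action[OF alg that] refl])
  \<comment> \<open>The exponentials of \<open>a\<close> and \<open>b\<close> are the candidate
    derivatives for \<mu> and \<sigma>: each reads the Busemann vector in the factor on which the
    original measure lives.\<close>
  define a where "a g x = \<psi>1 (busemann G1 (fst x) (mat 1) (fst g))" for g :: "'n mat \<times> 'm mat" and x :: "'n mat set \<times> 'm mat set"
  define b where "b g x = \<psi>2 (busemann G2 (snd x) (mat 1) (snd g))" for g :: "'n mat \<times> 'm mat" and x :: "'n mat set \<times> 'm mat set"
  have inv1: "AE \<xi> in \<nu>1. flag_action \<gamma> \<xi> \<in> \<Lambda>" if g: "\<gamma> \<in> \<Gamma>" for \<gamma>
    by (rule AE_distr_density_invariant[OF tm1[OF g] RN1(2)[OF g] _ S(1) \<nu>1(2)])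
      (use RN1(1)[OF g] in measurable)
  \<comment> \<open>Conformality gives measurability of the exponentials; composing with
    \<open>ln\<close> recovers it for the exponents.\<close>
  have am: "a (\<gamma>, \<rho> \<gamma>) \<in> borel_measurable N" and bm: "b (\<gamma>, \<rho> \<gamma>) \<in> borel_measurable N" if g: "\<gamma> \<in> \<Gamma>" for \<gamma>
  proof -
    have "(\<lambda>x. ln (exp (a (\<gamma>, \<rho> \<gamma>) x))) \<in> borel_measurable N"
      unfolding a_def fst_conv by (intro borel_measurable_ln measurable_compose[OF fstN RN1(1)[OF g]])
    then show "a (\<gamma>, \<rho> \<gamma>) \<in> borel_measurable N" by simp
    have "(\<lambda>x. ln (exp (b (\<gamma>, \<rho> \<gamma>) x))) \<in> borel_measurable N"
      unfolding b_def snd_conv by (intro borel_measurable_ln measurable_compose[OF sndN RN2(1)[OF g]])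
    then show "b (\<gamma>, \<rho> \<gamma>) \<in> borel_measurable N" by simp
  qed
  have em: "(\<lambda>x. ennreal (exp (r x))) \<in> borel_measurable N" if "r \<in> borel_measurable N" for r :: "_ \<Rightarrow> real"
    using that by measurable
  \<comment> \<open>By equivariance the graph map of \<open>f\<close> intertwines \<gamma> with
    \<open>(\<gamma>, \<rho> \<gamma>)\<close>, and \<open>a\<close> depends on the first coordinate
    only, so the derivative of \<nu>1 carries over.\<close>
  have \<mu>T: "distr \<mu> \<mu> (prod_flag_action (\<gamma>, \<rho> \<gamma>)) = density \<mu> (\<lambda>x. ennreal (exp (a (\<gamma>, \<rho> \<gamma>) x)))"
    if g: "\<gamma> \<in> \<Gamma>" for \<gamma>
    unfolding \<mu>_def
  proof (rule distr_push_density[OF P(1) S(1) \<nu>1(2) h1 tm1[OF g] RN1(2)[OF g]])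
    show "AE \<xi> in \<nu>1. \<xi> \<in> \<Lambda> \<longrightarrow> flag_action \<gamma> \<xi> \<in> \<Lambda> \<and>
        (flag_action \<gamma> \<xi>, f (flag_action \<gamma> \<xi>)) = prod_flag_action (\<gamma>, \<rho> \<gamma>) (\<xi>, f \<xi>)"
      using inv1[OF g] by eventually_elim (simp add: prod_flag_action_def equi[OF g])
    show "(\<lambda>\<eta>. ennreal (exp (\<psi>1 (busemann G1 \<eta> (mat 1) \<gamma>)))) \<in> borel_measurable \<nu>1"
      using RN1(1)[OF g] by measurable
    show "(\<lambda>x. ennreal (exp (a (\<gamma>, \<rho> \<gamma>) x))) \<in> borel_measurable N" by (rule em[OF am[OF g]])
  qed (auto simp: a_def intro!: TN \<Gamma>G[OF g])

  \<comment> \<open>Failure of absolute continuity on the product\<close>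
  have not_ac: "\<not> absolutely_continuous \<mu> \<sigma>"
  proof
    assume ac: "absolutely_continuous \<mu> \<sigma>"
    text \<open>Absolute continuity transfers the almost sure invariance of the limit set from
      \<open>\<nu>1\<close> to \<open>\<nu>2\<close>, so that \<open>f\<inverse>\<close> is equivariant almost everywhere.\<close>
    have inv2: "AE \<eta> in \<nu>2. \<eta> \<in> \<Lambda>\<rho> \<longrightarrow> flag_action \<gamma> (inv_into \<Lambda> f \<eta>) \<in> \<Lambda>" if g: "\<gamma> \<in> \<Gamma>" for \<gamma>
    proof -
      have "(\<lambda>x. flag_action \<gamma> (fst x)) \<in> measurable N \<nu>1"
        using measurable_compose[OF fstN tm1[OF g]] .
      then have m: "{x \<in> space N. flag_action \<gamma> (fst x) \<in> \<Lambda>} \<in> sets N"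
        using S(1) by measurable
      have "AE x in \<mu>. flag_action \<gamma> (fst x) \<in> \<Lambda>"
        unfolding \<mu>_def AE_distr_restrict_space[OF S(1) \<nu>1(2) h1 m] using inv1[OF g] by eventually_elim simp
      then have "AE x in \<sigma>. flag_action \<gamma> (fst x) \<in> \<Lambda>"
        by (rule absolutely_continuous_AE[OF _ ac, rotated]) (simp add: sets_\<mu>)
      then show ?thesis
        unfolding \<sigma>_def AE_distr_restrict_space[OF S(2) \<nu>2(2) h2 m] by simp
    qed
    have \<sigma>T: "distr \<sigma> \<sigma> (prod_flag_action (\<gamma>, \<rho> \<gamma>)) = density \<sigma> (\<lambda>x. ennreal (exp (b (\<gamma>, \<rho> \<gamma>) x)))"
      if g: "\<gamma> \<in> \<Gamma>" for \<gamma>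
      unfolding \<sigma>_def
    proof (rule distr_push_density[OF P(2) S(2) \<nu>2(2) h2 tm2[OF g] RN2(2)[OF g]])
      show "AE \<eta> in \<nu>2. \<eta> \<in> \<Lambda>\<rho> \<longrightarrow> flag_action (\<rho> \<gamma>) \<eta> \<in> \<Lambda>\<rho> \<and>
          (inv_into \<Lambda> f (flag_action (\<rho> \<gamma>) \<eta>), flag_action (\<rho> \<gamma>) \<eta>) =
          prod_flag_action (\<gamma>, \<rho> \<gamma>) (inv_into \<Lambda> f \<eta>, \<eta>)"
        using inv2[OF g]
      proof (eventually_elim, intro impI)
        fix \<eta> assume "\<eta> \<in> \<Lambda>\<rho> \<longrightarrow> flag_action \<gamma> (inv_into \<Lambda> f \<eta>) \<in> \<Lambda>" and \<eta>: "\<eta> \<in> \<Lambda>\<rho>"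
        then have \<xi>: "flag_action \<gamma> (inv_into \<Lambda> f \<eta>) \<in> \<Lambda>" by blast
        \<comment> \<open>Equivariance at the preimage of \<eta> exhibits the translate of \<eta> as
          a value of \<open>f\<close> on \<Lambda>, where injectivity evaluates
          \<open>inv_into\<close>.\<close>
        have e: "flag_action (\<rho> \<gamma>) \<eta> = f (flag_action \<gamma> (inv_into \<Lambda> f \<eta>))"
          using equi[OF g inv_f(1)[OF \<eta>]] inv_f(2)[OF \<eta>] by simp
        show "flag_action (\<rho> \<gamma>) \<eta> \<in> \<Lambda>\<rho> \<and>
          (inv_into \<Lambda> f (flag_action (\<rho> \<gamma>) \<eta>), flag_action (\<rho> \<gamma>) \<eta>) =
          prod_flag_action (\<gamma>, \<rho> \<gamma>) (inv_into \<Lambda> f \<eta>, \<eta>)"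
          unfolding prod_flag_action_def e fst_conv snd_conv inv_into_f_f[OF inj_f \<xi>]
          using \<xi> f(2) by (auto simp: e)
      qed
      show "(\<lambda>\<eta>. ennreal (exp (\<psi>2 (busemann G2 \<eta> (mat 1) (\<rho> \<gamma>))))) \<in> borel_measurable \<nu>2"
        using RN2(1)[OF g] by measurable
      show "(\<lambda>x. ennreal (exp (b (\<gamma>, \<rho> \<gamma>) x))) \<in> borel_measurable N" by (rule em[OF bm[OF g]])
    qed (auto simp: b_def intro!: TN \<Gamma>G[OF g])
    obtain u1 u2 where u: "(u1, u2) \<in> essential_subgroup G1 G2 nrm \<mu> (self_joining \<Gamma> \<rho>)"
      and ne: "\<not> (u1 \<in> alie G1 \<and> u2 \<in> alie G2 \<and> \<psi>1 u1 = \<psi>2 u2)"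
      using ess unfolding eqs by auto
    have ua: "u1 \<in> alie G1" "u2 \<in> alie G2" using u by (auto simp: essential_subgroup_def)
    obtain C where C: "C > 0"
      "\<And>v1 v2 w1 w2. v1 \<in> alie G1 \<Longrightarrow> v2 \<in> alie G2 \<Longrightarrow> w1 \<in> alie G1 \<Longrightarrow> w2 \<in> alie G2 \<Longrightarrow>
        \<bar>(\<psi>1 v1 - \<psi>2 v2) - (\<psi>1 w1 - \<psi>2 w2)\<bar> \<le> C * nrm ((v1, v2) - (w1, w2))"
      using weyl_invariant_norm_dominates_duals[OF nrm sub \<psi>] by blast
    \<comment> \<open>Half the gap: the bound for returns to \<open>B\<close> and the error in
      approximating \<open>(u1, u2)\<close> are each below \<delta>, so together they cannot reach
      the full gap.\<close>
    define \<delta> where "\<delta> = \<bar>\<psi>1 u1 - \<psi>2 u2\<bar> / 2"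
    have \<delta>: "\<delta> > 0" using ne ua by (simp add: \<delta>_def)
    obtain B where B: "B \<in> sets \<mu>" "emeasure \<mu> B > 0"
      "\<And>g. g \<in> self_joining \<Gamma> \<rho> \<Longrightarrow>
        AE x in \<mu>. x \<in> B \<inter> prod_flag_action g ` B \<longrightarrow> \<bar>a g x - b g x\<bar> < \<delta>"
    proof (rule absolutely_continuous_cocycles_close[OF prob _ ac, of "self_joining \<Gamma> \<rho>"
          prod_flag_action "\<lambda>g. prod_flag_action (matrix_inv (fst g), matrix_inv (snd g))" a b \<delta>])
      fix g assume "g \<in> self_joining \<Gamma> \<rho>"
      then obtain \<gamma> where g: "g = (\<gamma>, \<rho> \<gamma>)" "\<gamma> \<in> \<Gamma>" by (auto simp: self_joining_def)
      note m = measurable_cong_sets[OF refl sets_\<mu>(1)] measurable_cong_sets[OF sets_\<mu>(1) refl]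
      show "prod_flag_action g \<in> measurable \<mu> \<mu>"
        "prod_flag_action (matrix_inv (fst g), matrix_inv (snd g)) \<in> measurable \<mu> \<mu>"
        unfolding m using \<Gamma>G[OF g(2)] alg_group_inv[OF alg(1)] alg_group_inv[OF alg(2)]
        by (auto intro!: TN simp: g)
      show "prod_flag_action (matrix_inv (fst g), matrix_inv (snd g)) (prod_flag_action g x) = x" for x
        using \<Gamma>G[OF g(2)] alg_group_invertible[OF alg(1)] alg_group_invertible[OF alg(2)]
        by (simp add: prod_flag_action_def g flag_action_inv_left)
      show "a g \<in> borel_measurable \<mu>" "b g \<in> borel_measurable \<mu>"
        unfolding m g using am[OF g(2)] bm[OF g(2)] by auto
      show "distr \<mu> \<mu> (prod_flag_action g) = density \<mu> (\<lambda>x. ennreal (exp (a g x)))"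
        "distr \<sigma> \<sigma> (prod_flag_action g) = density \<sigma> (\<lambda>x. ennreal (exp (b g x)))"
        unfolding g using \<mu>T[OF g(2)] \<sigma>T[OF g(2)] by auto
    qed (use \<delta> sets_\<mu> in auto)
    \<comment> \<open>Within distance \<open>\<delta> / C\<close> of \<open>(u1, u2)\<close> the
      functional changes by less than \<delta>; essentiality is invoked with this radius.\<close>
    have "\<delta> / C > 0" using \<delta> C(1) by simp
    then obtain g where g: "g \<in> self_joining \<Gamma> \<rho>"
      and pos: "emeasure \<mu> (B \<inter> prod_flag_action g ` B \<inter>
               {\<xi> \<in> topspace (prod_flag_topology G1 G2).
                  prod_busemann G1 G2 \<xi> (mat 1, mat 1) g \<in> alie G1 \<times> alie G2 \<and>
                  nrm (prod_busemann G1 G2 \<xi> (mat 1, mat 1) g - (u1, u2)) < \<delta> / C}) > 0" (is "emeasure \<mu> ?S > 0")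
      using u B(1,2) unfolding essential_subgroup_def sets_\<mu> N_def by blast
    define E where "E = ?S"
    have E: "E \<subseteq> B \<inter> prod_flag_action g ` B" "emeasure \<mu> E \<noteq> 0" using pos by (auto simp: E_def)
    \<comment> \<open>Sets outside the sigma-algebra have measure 0 by convention, so nonzero
      measure already yields measurability.\<close>
    have sE: "E \<in> sets \<mu>" using E(2) emeasure_notin_sets by blast
    \<comment> \<open>The bound holds for almost every point of \<open>E\<close>, and
      \<open>E\<close> is not null, so some point of \<open>E\<close> satisfies it.\<close>
    have "\<exists>x\<in>E. \<bar>a g x - b g x\<bar> < \<delta>"
    proof (rule ccontr)
      assume no: "\<not> ?thesis"
      have "AE x in \<mu>. x \<notin> E" using B(3)[OF g] by eventually_elim (use no E(1) in blast)
      then show False using AE_iff_null_sets[OF sE] E(2) by auto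
    qed
    then obtain x where x: "x \<in> E" "\<bar>a g x - b g x\<bar> < \<delta>" by blast
    let ?v1 = "busemann G1 (fst x) (mat 1) (fst g)" and ?v2 = "busemann G2 (snd x) (mat 1) (snd g)"
    have v: "?v1 \<in> alie G1" "?v2 \<in> alie G2" "nrm ((?v1, ?v2) - (u1, u2)) < \<delta> / C"
      using x(1) by (auto simp: E_def prod_busemann_def)
    have "\<bar>(\<psi>1 ?v1 - \<psi>2 ?v2) - (\<psi>1 u1 - \<psi>2 u2)\<bar> \<le> C * nrm ((?v1, ?v2) - (u1, u2))"
      by (rule C(2)[OF v(1,2) ua])
    also have "\<dots> < \<delta>" using v(3) C(1) by (simp add: field_simps)
    finally show False using x(2) unfolding \<delta>_def a_def b_def by argo
  qed

  \<comment> \<open>Transfer to the second boundary\<close>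
  moreover have "absolutely_continuous \<mu> \<sigma>" if ac: "absolutely_continuous f_\<nu>1 \<nu>2"
    unfolding absolutely_continuous_def
  proof
    fix A assume A: "A \<in> null_sets \<mu>"
    then have AN: "A \<in> sets N" using sets_\<mu> by auto
    \<comment> \<open>The assumed absolute continuity is tested on the preimage \<open>Q\<close> of
      \<open>A\<close> in the second boundary, whose measure under \<nu>2 is that of
      \<open>A\<close> under \<sigma>.\<close>
    define Q where "Q = ?h2 -` A \<inter> space (restrict_space \<nu>2 \<Lambda>\<rho>)"
    have sp: "space (restrict_space \<nu>2 \<Lambda>\<rho>) = \<Lambda>\<rho>" "space (restrict_space \<nu>1 \<Lambda>) = \<Lambda>"
      using S sets.sets_into_space by (auto simp: space_restrict_space)
    have "Q \<in> sets (restrict_space \<nu>2 \<Lambda>\<rho>)" unfolding Q_def by (rule measurable_sets[OF h2 AN])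
    then have Q: "Q \<in> sets \<nu>2" using S(2) by (auto simp: sets_restrict_space)
    \<comment> \<open>On \<Lambda> the composite of \<open>f\<close> with \<open>?h2\<close> is
      \<open>?h1\<close>, so both sides are the same preimage of \<open>A\<close>.\<close>
    have "f -` Q \<inter> \<Lambda> = ?h1 -` A \<inter> \<Lambda>"
      using f(2) inj_f by (auto simp: Q_def sp)
    then have "emeasure f_\<nu>1 Q = emeasure \<mu> A"
      using Q s(2) AN by (simp add: eqs \<mu>_def emeasure_distr[OF fm] emeasure_distr[OF h1] sp)
    also have "\<dots> = 0" using A by auto
    finally have "emeasure \<nu>2 Q = 0"
      using absolutely_continuousD[OF ac] Q s(2) by (simp add: eqs)
    moreover have "emeasure \<sigma> A = emeasure (restrict_space \<nu>2 \<Lambda>\<rho>) Q"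
      unfolding \<sigma>_def Q_def by (rule emeasure_distr[OF h2 AN])
    moreover have "\<dots> = emeasure \<nu>2 Q"
      by (rule emeasure_restrict_space) (use S(2) sp in \<open>auto simp: Q_def\<close>)
    ultimately show "A \<in> null_sets \<sigma>" using AN sets_\<mu> by (auto simp: null_sets_def)
  qed
  ultimately show ?thesis unfolding eqs(1,2) by blast
qed

end
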